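(* Let $\mathcal{A}$ be the age of an almost multichainable relational structure. Then (1) $\mathcal{A}$ is very-well-quasi-ordered; and (2) the height $H(\mathcal{A})$ is defined and $H(\mathcal{A})<\omega^{\omega}$.
   Context: Relational structure $R=(E,(\rho_i)_{i\in I})$, $\rho_i\subseteq E^{m_i}$; local isomorphism = isomorphism between induced substructures. $R$ is almost multichainable if there are a finite $F\subseteq E$, a finite set $V$, a linearly ordered set $L$ and a bijective enumeration $(a_{x,y})_{(x,y)\in V\times L}$ of $E\setminus F$ such that for every local isomorphism $f$ of $L$, the map $a_{x,y}\mapsto a_{x,f(y)}$ extended by the identity on $F$ is a local isomorphism of $R$. The age $\mathcal{A}(R)$ is the set of isomorphism types of finite induced substructures, ordered by embeddability; it is an ideal of the poset $\Omega_\mu$ of types of finite structures of the signature $\mu$. A poset is well-quasi-ordered if every non-empty subset has finitely many and at least one minimal elements. A class $\mathcal{C}$ of structures is very-well-quasi-ordered if for every integer $m$, the class of structures obtained from members of $\mathcal{C}$ by adding $m$ unary relations is well-quasi-ordered under embeddability. Height: $h(x)=\sup\{h(y)+1:y<x\}$; $H(\mathcal{A})$ is the height of $\mathcal{A}$ in the set of ideals of $\Omega_\mu$ contained in $\mathcal{A}$, ordered by inclusion. *)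

theory Defs
  imports Main
begin

section \<open>Relational structures\<close>

text \<open>The index set is an explicit set, so that it may be empty and so that unary
  relations can be added to it. An \<open>n\<close>-ary relation is a set of lists of length \<open>n\<close>.\<close>

record 'i signature =
  idx :: "'i set"
  arity :: "'i \<Rightarrow> nat"

record ('a, 'i) rel_structure =
  universe :: "'a set"
  rel :: "'i \<Rightarrow> 'a list set"

text \<open>The values of \<open>rel\<close> outside the index set of the signature carry no meaning; no
  definition below depends on them.\<close>

definition structure_of :: "'i signature \<Rightarrow> ('a, 'i) rel_structure \<Rightarrow> bool" where
  "structure_of \<mu> S \<longleftrightarrow>
     (\<forall>i\<in>idx \<mu>. rel S i \<subseteq> {xs. length xs = arity \<mu> i \<and> set xs \<subseteq> universe S})"

definition induced :: "('a, 'i) rel_structure \<Rightarrow> 'a set \<Rightarrow> ('a, 'i) rel_structure" where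
  "induced S A = \<lparr>universe = A, rel = (\<lambda>i. {xs \<in> rel S i. set xs \<subseteq> A})\<rparr>"

definition is_iso ::
  "'i signature \<Rightarrow> ('a, 'i) rel_structure \<Rightarrow> ('b, 'i) rel_structure \<Rightarrow> ('a \<Rightarrow> 'b) \<Rightarrow> bool" where
  "is_iso \<mu> S T f \<longleftrightarrow>
     bij_betw f (universe S) (universe T) \<and>
     (\<forall>i\<in>idx \<mu>. \<forall>xs. length xs = arity \<mu> i \<and> set xs \<subseteq> universe S \<longrightarrow>
        (xs \<in> rel S i \<longleftrightarrow> map f xs \<in> rel T i))"

definition isomorphic :: "'i signature \<Rightarrow> ('a, 'i) rel_structure \<Rightarrow> ('b, 'i) rel_structure \<Rightarrow> bool" where
  "isomorphic \<mu> S T \<longleftrightarrow> (\<exists>f. is_iso \<mu> S T f)"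

definition embeds :: "'i signature \<Rightarrow> ('a, 'i) rel_structure \<Rightarrow> ('b, 'i) rel_structure \<Rightarrow> bool" where
  "embeds \<mu> S T \<longleftrightarrow> (\<exists>B. B \<subseteq> universe T \<and> isomorphic \<mu> S (induced T B))"

text \<open>A local isomorphism is a partial map; it is given by its domain \<open>A\<close> and a total
  function \<open>f\<close>, of which only the restriction to \<open>A\<close> matters.\<close>

definition local_iso :: "'i signature \<Rightarrow> ('a, 'i) rel_structure \<Rightarrow> 'a set \<Rightarrow> ('a \<Rightarrow> 'a) \<Rightarrow> bool" where
  "local_iso \<mu> S A f \<longleftrightarrow>
     A \<subseteq> universe S \<and> f ` A \<subseteq> universe S \<and> is_iso \<mu> (induced S A) (induced S (f ` A)) f"


section \<open>Almost multichainable structures\<close>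

definition order_signature :: "unit signature" where
  "order_signature = \<lparr>idx = UNIV, arity = (\<lambda>_. 2)\<rparr>"

definition order_struct :: "'l set \<Rightarrow> 'l rel \<Rightarrow> ('l, unit) rel_structure" where
  "order_struct L r =
     \<lparr>universe = L, rel = (\<lambda>_. {[y, z] | y z. y \<in> L \<and> z \<in> L \<and> (y, z) \<in> r})\<rparr>"

definition extend_map ::
  "'a set \<Rightarrow> 'v set \<Rightarrow> 'l set \<Rightarrow> ('v \<times> 'l \<Rightarrow> 'a) \<Rightarrow> ('l \<Rightarrow> 'l) \<Rightarrow> 'a \<Rightarrow> 'a" where
  "extend_map F V L a f z =
     (if z \<in> F then z
      else case the_inv_into (V \<times> L) a z of (x, y) \<Rightarrow> a (x, f y))"

text \<open>A definition cannot quantify existentially over types, so the types in which \<open>V\<close> and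
  \<open>L\<close> live are parameters. They are free in a theorem that assumes this predicate, hence
  arbitrary there.\<close>

definition almost_multichainable ::
  "'v itself \<Rightarrow> 'l itself \<Rightarrow> 'i signature \<Rightarrow> ('a, 'i) rel_structure \<Rightarrow> bool" where
  "almost_multichainable tyV tyL \<mu> R \<longleftrightarrow>
     (\<exists>(F :: 'a set) (V :: 'v set) (L :: 'l set) (r :: 'l rel) (a :: 'v \<times> 'l \<Rightarrow> 'a).
        finite F \<and> F \<subseteq> universe R \<and> finite V \<and> linear_order_on L r \<and>
        bij_betw a (V \<times> L) (universe R - F) \<and>
        (\<forall>A f. local_iso order_signature (order_struct L r) A f \<longrightarrow>
           local_iso \<mu> R (F \<union> a ` (V \<times> A)) (extend_map F V L a f)))"


section \<open>Isomorphism types and ages\<close>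

text \<open>The isomorphism type of a finite structure is the class of its isomorphic copies on
  sets of natural numbers.\<close>

definition iso_type :: "'i signature \<Rightarrow> ('a, 'i) rel_structure \<Rightarrow> (nat, 'i) rel_structure set" where
  "iso_type \<mu> S = {T. structure_of \<mu> T \<and> isomorphic \<mu> S T}"

definition Omega :: "'i signature \<Rightarrow> (nat, 'i) rel_structure set set" where
  "Omega \<mu> = {iso_type \<mu> S | S :: (nat, 'i) rel_structure. structure_of \<mu> S \<and> finite (universe S)}"

definition type_le ::
  "'i signature \<Rightarrow> (nat, 'i) rel_structure set \<Rightarrow> (nat, 'i) rel_structure set \<Rightarrow> bool" where
  "type_le \<mu> t u \<longleftrightarrow> (\<exists>S\<in>t. \<exists>T\<in>u. embeds \<mu> S T)"

definition age :: "'i signature \<Rightarrow> ('a, 'i) rel_structure \<Rightarrow> (nat, 'i) rel_structure set set" where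
  "age \<mu> R = {iso_type \<mu> (induced R A) | A. finite A \<and> A \<subseteq> universe R}"


section \<open>Well-quasi-order\<close>

definition minimal_elements :: "('b \<Rightarrow> 'b \<Rightarrow> bool) \<Rightarrow> 'b set \<Rightarrow> 'b set" where
  "minimal_elements le X = {x \<in> X. \<forall>y\<in>X. le y x \<longrightarrow> y = x}"

definition well_quasi_ordered :: "('b \<Rightarrow> 'b \<Rightarrow> bool) \<Rightarrow> 'b set \<Rightarrow> bool" where
  "well_quasi_ordered le P \<longleftrightarrow>
     (\<forall>X. X \<subseteq> P \<and> X \<noteq> {} \<longrightarrow>
        finite (minimal_elements le X) \<and> minimal_elements le X \<noteq> {})"

definition add_unary_signature :: "nat \<Rightarrow> 'i signature \<Rightarrow> ('i + nat) signature" where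
  "add_unary_signature m \<mu> =
     \<lparr>idx = idx \<mu> <+> {..<m}, arity = case_sum (arity \<mu>) (\<lambda>_. 1)\<rparr>"

definition add_unary :: "('a, 'i) rel_structure \<Rightarrow> (nat \<Rightarrow> 'a set) \<Rightarrow> ('a, 'i + nat) rel_structure" where
  "add_unary S U =
     \<lparr>universe = universe S, rel = case_sum (rel S) (\<lambda>j. {[x] | x. x \<in> U j})\<rparr>"

text \<open>The class \<open>C\<close> is given by the isomorphism types of its members. Its expansions are
  compared through their isomorphism types as well, on which embeddability is a partial
  order.\<close>

definition very_well_quasi_ordered ::
  "'i signature \<Rightarrow> (nat, 'i) rel_structure set set \<Rightarrow> bool" where
  "very_well_quasi_ordered \<mu> C \<longleftrightarrow>
     (\<forall>m. well_quasi_ordered (type_le (add_unary_signature m \<mu>))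
        {iso_type (add_unary_signature m \<mu>) (add_unary S U) | S U.
           S \<in> \<Union>C \<and> (\<forall>j<m. U j \<subseteq> universe S)})"


section \<open>Ideals and height\<close>

definition order_ideal :: "('b \<Rightarrow> 'b \<Rightarrow> bool) \<Rightarrow> 'b set \<Rightarrow> 'b set \<Rightarrow> bool" where
  "order_ideal le P J \<longleftrightarrow>
     J \<subseteq> P \<and> J \<noteq> {} \<and>
     (\<forall>x\<in>J. \<forall>y\<in>P. le y x \<longrightarrow> y \<in> J) \<and>
     (\<forall>x\<in>J. \<forall>y\<in>J. \<exists>z\<in>J. le x z \<and> le y z)"

text \<open>Ordinals are well-orders, compared by \<open>ordLess\<close> and \<open>ordLeq\<close>. In \<open>has_height lt P x \<alpha>\<close> the
  ordinal \<open>\<alpha>\<close> is the supremum of the \<open>h y + 1\<close> for \<open>y < x\<close>, that is, the least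
  ordinal above all \<open>h y\<close>. As the predicate is inductive, an \<open>\<alpha>\<close> exists only if the recursion
  below \<open>x\<close> is well-founded, i.e. if the height of \<open>x\<close> is defined. The ordinals of type
  \<open>'o rel\<close> form an initial segment of all ordinals, so that minimality among them is
  minimality among all ordinals.\<close>

inductive has_height :: "('b \<Rightarrow> 'b \<Rightarrow> bool) \<Rightarrow> 'b set \<Rightarrow> 'b \<Rightarrow> 'o rel \<Rightarrow> bool"
  for lt :: "'b \<Rightarrow> 'b \<Rightarrow> bool" and P :: "'b set" where
  "\<lbrakk>x \<in> P;
    \<And>y. \<lbrakk>y \<in> P; lt y x\<rbrakk> \<Longrightarrow> has_height lt P y (h y);
    Well_order \<alpha>;
    \<And>y. \<lbrakk>y \<in> P; lt y x\<rbrakk> \<Longrightarrow> (h y, \<alpha>) \<in> ordLess;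
    \<And>\<beta> :: 'o rel. \<lbrakk>Well_order \<beta>; \<And>y. \<lbrakk>y \<in> P; lt y x\<rbrakk> \<Longrightarrow> (h y, \<beta>) \<in> ordLess\<rbrakk> \<Longrightarrow> (\<alpha>, \<beta>) \<in> ordLeq\<rbrakk>
   \<Longrightarrow> has_height lt P x \<alpha>"

definition has_age_height ::
  "'i signature \<Rightarrow> (nat, 'i) rel_structure set set \<Rightarrow> 'o rel \<Rightarrow> bool" where
  "has_age_height \<mu> \<A> \<alpha> \<longleftrightarrow>
     has_height (\<subset>) {J. order_ideal (type_le \<mu>) (Omega \<mu>) J \<and> J \<subseteq> \<A>} \<A> \<alpha>"

text \<open>\<open>\<omega>\<^sup>\<omega>\<close> by Cantor normal form: a finitely supported \<open>f\<close> stands for the sum of the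
  \<open>\<omega>\<^sup>n \<cdot> f n\<close> with decreasing \<open>n\<close>.\<close>

definition omega_pow_omega :: "(nat \<Rightarrow> nat) rel" where
  "omega_pow_omega =
     {(f, g). finite {n. f n \<noteq> 0} \<and> finite {n. g n \<noteq> 0} \<and>
        (f = g \<or> (\<exists>n. f n < g n \<and> (\<forall>k>n. f k = g k)))}"

lemma Field_omega_pow_omega: "Field omega_pow_omega = {f. finite {n. f n \<noteq> 0}}"
  unfolding omega_pow_omega_def Field_def by auto

lemma greatest_difference: assumes "finite {n. f n \<noteq> (0::nat)}" "finite {n. g n \<noteq> (0::nat)}" "f \<noteq> g"
  shows "\<exists>n::nat. f n \<noteq> g n \<and> (\<forall>k>n. f k = g k)"
proof -
  let ?D = "{n. f n \<noteq> g n}"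
  have fin: "finite ?D"
    by (rule finite_subset[of _ "{n. f n \<noteq> 0} \<union> {n. g n \<noteq> 0}"]) (use assms in auto)
  have ne: "?D \<noteq> {}" using assms(3) by auto
  have "Max ?D \<in> ?D" using fin ne Max_in by blast
  moreover have "\<forall>k>Max ?D. f k = g k" using fin Max_ge by (metis (mono_tags) leD mem_Collect_eq)
  ultimately show ?thesis by blast
qed

lemma wf_bounded_support: "wf {(f::nat\<Rightarrow>nat,g). (\<forall>k\<ge>(N::nat). f k = (0::nat)) \<and> (\<forall>k\<ge>N. g k = 0) \<and> (\<exists>n. f n < g n \<and> (\<forall>k>n. f k = g k))}"
  (is "wf (?r N)")
proof (induction N)
  case 0
  have "?r 0 = {}" by auto
  then show ?case by (simp only:) simp
next
  case (Suc N)
  have "wf (inv_image (less_than <*lex*> ?r N) (\<lambda>f. (f N, \<lambda>k. if k < N then f k else 0)))"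
    by (intro wf_inv_image wf_lex_prod wf_less_than Suc)
  then show ?case
  proof (rule wf_subset, clarify)
    fix f g :: "nat \<Rightarrow> nat" and n
    assume a: "\<forall>k\<ge>Suc N. f k = 0" "\<forall>k\<ge>Suc N. g k = 0" "f n < g n" "\<forall>k>n. f k = g k"
    have "n \<le> N" using a by (metis not_less_eq_eq less_irrefl)
    show "(f, g) \<in> inv_image (less_than <*lex*> ?r N) (\<lambda>f. (f N, \<lambda>k. if k < N then f k else 0))"
    proof (cases "n = N")
      case True then show ?thesis using a by simp
    next
      case False
      then have "n < N" using \<open>n \<le> N\<close> by simp
      then show ?thesis using a by (auto intro!: exI[of _ n])
    qed
  qed
qed

lemma wf_omega_pow_omega: "wf (omega_pow_omega - Id)"
proof (rule wfI_min)
  fix x :: "nat \<Rightarrow> nat" and Q assume x: "x \<in> Q"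
  show "\<exists>z\<in>Q. \<forall>y. (y, z) \<in> omega_pow_omega - Id \<longrightarrow> y \<notin> Q"
  proof (cases "finite {n. x n \<noteq> 0}")
    case False
    then show ?thesis using x by (auto simp: omega_pow_omega_def)
  next
    case True
    then obtain N where N: "\<forall>k\<ge>N. x k = 0"
      by (metis (mono_tags, lifting) finite_nat_set_iff_bounded mem_Collect_eq leD)
    let ?Q = "{f\<in>Q. \<forall>k\<ge>N. f k = 0}"
    have "x \<in> ?Q" using x N by simp
    from wfE_min[OF wf_bounded_support[of N] this] obtain z where z: "z \<in> ?Q"
      and m: "\<And>y. (y, z) \<in> {(f,g). (\<forall>k\<ge>N. f k = (0::nat)) \<and> (\<forall>k\<ge>N. g k = 0) \<and> (\<exists>n. f n < g n \<and> (\<forall>k>n. f k = g k))} \<Longrightarrow> y \<notin> ?Q" by blast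
    have "y \<notin> Q" if y: "(y, z) \<in> omega_pow_omega - Id" for y
    proof
      assume "y \<in> Q"
      from y obtain n where n: "y n < z n" "\<forall>k>n. y k = z k" by (auto simp: omega_pow_omega_def)
      then have "n < N" using z by (metis (mono_tags, lifting) mem_Collect_eq not_less not_less_zero)
      then have "\<forall>k\<ge>N. y k = 0" using n z by auto
      then show False using m[of y] n z \<open>y \<in> Q\<close> by auto
    qed
    then show ?thesis using z by blast
  qed
qed

lemma Well_order_omega_pow_omega: "Well_order omega_pow_omega"
proof -
  have a: "f = g" if fg: "(f,g) \<in> omega_pow_omega" "(g,f) \<in> omega_pow_omega" for f g
  proof (rule ccontr)
    assume "f \<noteq> g"
    then obtain n m where "f n < g n" "\<forall>k>n. f k = g k" "g m < f m" "\<forall>k>m. g k = f k"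
      using fg by (auto simp: omega_pow_omega_def)
    then show False by (metis less_asym linorder_neqE_nat less_irrefl)
  qed
  have t: "(f,h) \<in> omega_pow_omega" if fg: "(f,g) \<in> omega_pow_omega" and gh: "(g,h) \<in> omega_pow_omega" for f g h
  proof (cases "f = g \<or> g = h")
    case True then show ?thesis using that by auto
  next
    case False
    then obtain n m where nm: "f n < g n" "\<forall>k>n. f k = g k" "g m < h m" "\<forall>k>m. g k = h k"
      using fg gh by (auto simp: omega_pow_omega_def)
    have "f (max n m) < h (max n m) \<and> (\<forall>k>max n m. f k = h k)"
      using nm by (cases n m rule: linorder_cases) (auto simp: max_def)
    then show ?thesis using that by (auto simp: omega_pow_omega_def)
  qed
  have l: "(f,g) \<in> omega_pow_omega \<or> (g,f) \<in> omega_pow_omega" if fin: "finite {n. f n \<noteq> 0}" "finite {n. g n \<noteq> 0}" "f \<noteq> g" for f g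
  proof -
    from greatest_difference[OF fin] obtain n where "f n \<noteq> g n" "\<forall>k>n. f k = g k" by blast
    then show ?thesis using fin unfolding omega_pow_omega_def by (auto simp: neq_iff) 
  qed
  show ?thesis
    unfolding well_order_on_def linear_order_on_def partial_order_on_def preorder_on_def
  proof (intro conjI)
    show "omega_pow_omega \<subseteq> Field omega_pow_omega \<times> Field omega_pow_omega"
      by (auto intro: FieldI1 FieldI2)
    show "refl_on (Field omega_pow_omega) omega_pow_omega"
      unfolding Field_omega_pow_omega refl_on_def by (auto simp: omega_pow_omega_def)
    show "trans omega_pow_omega" using t by (blast intro: transI)
    show "antisym omega_pow_omega" using a by (blast intro: antisymI)
    show "total_on (Field omega_pow_omega) omega_pow_omega"
      using l by (auto simp: Field_omega_pow_omega total_on_def)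
    show "wf (omega_pow_omega - Id)" by (rule wf_omega_pow_omega)
  qed
qed

end

(* The age of an almost multichainable structure is the image of the finite words over the
   alphabet of subsets of V (together with the subset of F that is used): the points of a finite
   part are read along L. If a word embeds letterwise into another one, a local isomorphism of L
   carries the first part into the second. Down-sets of words are handled through products of
   atoms Opt B (at most one letter, from B) and Star B (any word over B). The words of such a
   product that do not embed a given word of it lie in finitely many products of smaller rank,
   where Star B has rank omega^|B| and ranks are combined by the natural sum. Descending on ranks
   excludes bad sequences and, since an ideal covered by finitely many down-sets lies in one of
   them, makes the least rank of a product covering an ideal strictly monotone. *)

theory Submission
  imports Defs "HOL-Library.Sublist" "HOL-Library.Countable_Set"
begin

section \<open>Words and products of atoms\<close>

text \<open>The coding is not faithful: comparable codes give comparable types, but comparable types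
  may have incomparable codes, and one type has many codes. Ideals of types are therefore not ideals
  of words, and the argument cannot be run on words alone and translated back. What survives is the
  contrapositive: all codes of a type not above \<open>t\<close> fail to lie above a given code of
  \<open>t\<close>. This suffices to carry the peeling of words over to sets of types, so the
  descent takes place in an abstract family of down-sets of types. Unary relations do not leave the
  setting: with \<open>m\<close> of them, \<open>F\<close> and \<open>V\<close> become 2^m times as
  large while \<open>L\<close> is unchanged, so part (1) is plain well-quasi-order for a larger
  structure of the same kind. The height compares ideals, not types, and is obtained from the ranks
  directly instead of from part (1).\<close>

definition cnf_less :: "(nat \<Rightarrow> nat) rel" where
  "cnf_less = omega_pow_omega - Id"

lemma cnf_lessI:
  assumes "finite {n. f n \<noteq> 0}" "finite {n. g n \<noteq> 0}" "f n < g n" "\<And>k. k > n \<Longrightarrow> f k = g k"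
  shows "(f, g) \<in> cnf_less"
  using assms unfolding cnf_less_def omega_pow_omega_def by (auto intro!: exI[of _ n])

lemma cnf_lessE:
  assumes "(f, g) \<in> cnf_less"
  obtains n where "f n < g n" "\<And>k. k > n \<Longrightarrow> f k = g k" "finite {n. f n \<noteq> 0}" "finite {n. g n \<noteq> 0}"
  using assms unfolding cnf_less_def omega_pow_omega_def by auto

text \<open>Adding coefficients is the natural sum. It leaves the greatest position of difference
  and its direction unchanged, whereas the ordinary ordinal sum is not strictly monotone in its left
  argument.\<close>

lemma cnf_less_add_right:
  assumes "(f, g) \<in> cnf_less" "finite {n. h n \<noteq> 0}"
  shows "(\<lambda>n. f n + h n, \<lambda>n. g n + h n) \<in> cnf_less"
proof -
  from assms(1) obtain n where n: "f n < g n" "\<And>k. k > n \<Longrightarrow> f k = g k"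
    and fin: "finite {n. f n \<noteq> 0}" "finite {n. g n \<noteq> 0}" by (elim cnf_lessE) blast
  have "finite {n. f n + h n \<noteq> 0}" "finite {n. g n + h n \<noteq> 0}"
    by (rule finite_subset[OF _ finite_UnI[OF fin(1) assms(2)]]; auto)
      (rule finite_subset[OF _ finite_UnI[OF fin(2) assms(2)]]; auto)
  then show ?thesis
    by (rule cnf_lessI[where n = n]) (use n in auto)
qed

lemma cnf_less_add_left:
  assumes "(f, g) \<in> cnf_less" "finite {n. h n \<noteq> 0}"
  shows "(\<lambda>n. h n + f n, \<lambda>n. h n + g n) \<in> cnf_less"
  using cnf_less_add_right[OF assms] by (simp add: add.commute)

section \<open>Products of atoms: languages and ranks\<close>

datatype 's atom = Opt (letters: "'s set") | Star (letters: "'s set")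

fun atom_lang :: "'s atom \<Rightarrow> 's list set" where
  "atom_lang (Opt B) = {w \<in> lists B. length w \<le> 1}"
| "atom_lang (Star B) = lists B"

fun lang :: "'s atom list \<Rightarrow> 's list set" where
  "lang [] = {[]}"
| "lang (X # p) = {u @ v | u v. u \<in> atom_lang X \<and> v \<in> lang p}"

text \<open>The \<open>Suc\<close> leaves room below \<open>Opt {}\<close>, whose language still contains the empty word.\<close>

fun atom_rank :: "'s atom \<Rightarrow> nat \<Rightarrow> nat" where
  "atom_rank (Opt B) n = (if n = 0 then Suc (card B) else 0)"
| "atom_rank (Star B) n = (if n = card B then 1 else 0)"

definition rank :: "'s atom list \<Rightarrow> nat \<Rightarrow> nat" where
  "rank p n = (\<Sum>X\<leftarrow>p. atom_rank X n)"

lemma rank_Nil [simp]: "rank [] = (\<lambda>n. 0)"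
  and rank_Cons: "rank (X # p) = (\<lambda>n. atom_rank X n + rank p n)"
  and rank_append: "rank (p @ q) = (\<lambda>n. rank p n + rank q n)"
  by (simp_all add: rank_def fun_eq_iff)

lemma finite_atom_rank: "finite {n. atom_rank X n \<noteq> 0}"
  by (rule finite_subset[of _ "{0, card (letters X)}"]) (cases X; auto split: if_splits)+

lemma finite_rank: "finite {n. rank p n \<noteq> 0}"
proof (induction p)
  case (Cons X p)
  show ?case
    by (rule finite_subset[OF _ finite_UnI[OF finite_atom_rank[of X] Cons.IH]])
      (auto simp: rank_Cons)
qed simp

lemma lang_append:
  assumes "u \<in> lang p" "v \<in> lang q" shows "u @ v \<in> lang (p @ q)"
  using assms
proof (induction p arbitrary: u)
  case (Cons X p)
  then obtain x y where "u = x @ y" "x \<in> atom_lang X" "y \<in> lang p" by auto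
  with Cons.IH[of y] Cons.prems(2) show ?case
    unfolding append_Cons lang.simps by (intro CollectI exI[of _ x] exI[of _ "y @ v"]) simp
qed simp

text \<open>Down-closed letters make the languages closed under shrinking letters; finiteness makes
  \<open>card\<close> meaningful in \<open>atom_rank\<close>.\<close>

definition good_atom :: "'s::preorder atom \<Rightarrow> bool" where
  "good_atom X \<longleftrightarrow> finite (letters X) \<and> (\<forall>b\<in>letters X. \<forall>a\<le>b. a \<in> letters X)"

definition good :: "'s::preorder atom list \<Rightarrow> bool" where
  "good p \<longleftrightarrow> (\<forall>X\<in>set p. good_atom X)"

lemma good_simps [simp]:
  "good []" "good (X # p) \<longleftrightarrow> good_atom X \<and> good p" "good (p @ q) \<longleftrightarrow> good p \<and> good q"
  by (auto simp: good_def)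

lemma good_atom_remove:
  assumes "finite B" "\<forall>b\<in>B. \<forall>a\<le>b. a \<in> B"
  shows "good_atom (Opt (B - {b. c \<le> b}))" "good_atom (Star (B - {b. c \<le> b}))"
proof -
  have "a \<in> B - {b. c \<le> b}" if "b \<in> B - {b. c \<le> b}" "a \<le> b" for a b
    using that assms(2) order_trans[of c a b] by auto
  with assms(1) show "good_atom (Opt (B - {b. c \<le> b}))" "good_atom (Star (B - {b. c \<le> b}))"
    unfolding good_atom_def atom.sel by blast+
qed

lemma atom_lang_downward:
  assumes "good_atom X" "v \<in> atom_lang X" "list_all2 (\<le>) u v"
  shows "u \<in> atom_lang X"
proof -
  have "set u \<subseteq> letters X"
  proof
    fix c assume "c \<in> set u"
    then obtain d where "d \<in> set v" "c \<le> d"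
      using assms(3) by (metis in_set_conv_nth list_all2_conv_all_nth)
    then show "c \<in> letters X"
      using assms(1,2) unfolding good_atom_def by (cases X; simp) blast+
  qed
  then show ?thesis using assms(2) list_all2_lengthD[OF assms(3)] by (cases X) auto
qed

text \<open>Words of equal length suffice: removing points from a coded set shrinks letters,
  possibly to the empty set, but keeps every position (\<open>codes_subset\<close>).\<close>

lemma lang_downward:
  assumes "good p" "v \<in> lang p" "list_all2 (\<le>) u v"
  shows "u \<in> lang p"
  using assms
proof (induction p arbitrary: u v)
  case (Cons X p)
  then obtain x y where v: "v = x @ y" "x \<in> atom_lang X" "y \<in> lang p" by auto
  with Cons.prems(3) obtain x' y' where u: "u = x' @ y'" "list_all2 (\<le>) x' x" "list_all2 (\<le>) y' y"
    by (auto simp: list_all2_append2)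
  have "x' \<in> atom_lang X" using atom_lang_downward[OF _ v(2) u(2)] Cons.prems(1) by simp
  moreover have "y' \<in> lang p" using Cons.IH[OF _ v(3) u(3)] Cons.prems(1) by simp
  ultimately show ?case using u(1) by auto
qed simp

text \<open>A word over \<open>B\<close> that does not embed \<open>b # w\<close> either avoids the letters above \<open>b\<close>,
  or its part behind the first such letter does not embed \<open>w\<close>.\<close>

fun avoiding :: "'s::preorder set \<Rightarrow> 's list \<Rightarrow> 's atom list" where
  "avoiding B [] = []"
| "avoiding B (b # w) = Star (B - {c. b \<le> c}) # Opt B # avoiding B w"

text \<open>Either the first \<open>Star\<close> takes the whole word and the later factors take the
  empty word, or \<open>Opt B\<close> takes the first letter above \<open>b\<close>; what follows
  cannot embed \<open>w\<close>, since otherwise \<open>b # w\<close> would embed.\<close>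

lemma lang_avoiding:
  assumes "u \<in> lists B" "\<not> list_emb (\<le>) w u"
  shows "u \<in> lang (avoiding B w)"
  using assms
proof (induction w arbitrary: u)
  case (Cons b w)
  have nil: "[] \<in> lang (avoiding B v)" for v by (induction v) auto
  show ?case
  proof (cases "\<exists>c\<in>set u. b \<le> c")
    case False
    with Cons.prems(1) have "u \<in> atom_lang (Star (B - {c. b \<le> c}))" by auto
    moreover have "[] \<in> lang (Opt B # avoiding B w)" using nil[of w] by auto
    ultimately show ?thesis unfolding avoiding.simps lang.simps(2)[of "Star _"]
      by (intro CollectI exI[of _ u] exI[of _ "[]"]) simp
  next
    case True
    then obtain x c y where u: "u = x @ c # y" "b \<le> c" "\<forall>d\<in>set x. \<not> b \<le> d"
      using split_list_first_prop[of u "\<lambda>c. b \<le> c"] by blast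
    have "\<not> list_emb (\<le>) w y"
    proof
      assume "list_emb (\<le>) w y"
      then have "list_emb (\<le>) (b # w) (c # y)" using u(2) by blast
      then show False using Cons.prems(2) u(1) by (metis list_emb_append2)
    qed
    with Cons have "y \<in> lang (avoiding B w)" using u(1) by auto
    then have "[c] @ y \<in> lang (Opt B # avoiding B w)" using Cons.prems(1) u(1)
      by (subst lang.simps, intro CollectI exI[of _ "[c]"] exI[of _ y]) simp
    moreover have "x \<in> atom_lang (Star (B - {c. b \<le> c}))" using u(1,3) Cons.prems(1) by auto
    ultimately show ?thesis unfolding u(1) avoiding.simps(2)
      by (subst lang.simps, intro CollectI exI[of _ x] exI[of _ "[c] @ y"]) simp
  qed
qed simp

lemma good_avoiding:
  assumes "finite B" "\<forall>b\<in>B. \<forall>a\<le>b. a \<in> B"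
  shows "good (avoiding B w)"
proof -
  have "good_atom (Opt B)" using assms unfolding good_atom_def atom.sel by blast
  then show ?thesis by (induction w) (simp_all add: good_atom_remove(2)[OF assms])
qed

text \<open>Each \<open>Star\<close> factor loses the letter \<open>b\<close> itself, so its
  exponent is below \<open>card B\<close>. The \<open>Opt\<close> factors sit at exponent 0, also
  below \<open>card B\<close> because \<open>b\<close> lies in \<open>B\<close>. Thus all exponents
  stay below the one of \<open>Star B\<close>.\<close>

lemma rank_avoiding:
  assumes "finite B" "w \<in> lists B" "n \<ge> card B"
  shows "rank (avoiding B w) n = 0"
  using assms(2)
proof (induction w)
  case (Cons b w)
  then have "b \<in> B" by simp
  then have "B - {c. b \<le> c} \<subset> B" by auto
  then have "card (B - {c. b \<le> c}) < card B" using assms(1) by (rule psubset_card_mono[rotated])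
  with Cons assms(3) show ?case by (auto simp: rank_Cons)
qed simp

lemma atom_peel:
  assumes "good_atom X" "w \<in> atom_lang X"
  obtains q where "good q" "(rank q, atom_rank X) \<in> cnf_less"
    "\<And>u. u \<in> atom_lang X \<Longrightarrow> \<not> list_emb (\<le>) w u \<Longrightarrow> u \<in> lang q"
proof (cases X)
  case (Star B)
  have B: "finite B" "\<forall>b\<in>B. \<forall>a\<le>b. a \<in> B" and w: "w \<in> lists B"
    using assms Star by (auto simp: good_atom_def)
  have "(rank (avoiding B w), atom_rank X) \<in> cnf_less"
    by (rule cnf_lessI[OF finite_rank finite_atom_rank, where n = "card B"])
      (use rank_avoiding[OF B(1) w] Star in auto)
  then show ?thesis
    using that good_avoiding[OF B] lang_avoiding[of _ B w] Star by auto
next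
  case (Opt B)
  have B: "finite B" "\<forall>b\<in>B. \<forall>a\<le>b. a \<in> B" using assms Opt by (auto simp: good_atom_def)
  show ?thesis
  proof (cases w)
    case Nil
    \<comment> \<open>The empty word embeds everywhere, so nothing has to be covered and any product
      of smaller rank will do; the \<open>Suc\<close> in \<open>atom_rank\<close> puts the empty
      product below \<open>Opt B\<close>.\<close>
    have "(rank ([] :: 'a atom list), atom_rank X) \<in> cnf_less"
      by (rule cnf_lessI[OF finite_rank finite_atom_rank, where n = 0]) (use Opt in auto)
    then show ?thesis using that[of "[]"] Nil by auto
  next
    case (Cons b v)
    then have b: "b \<in> B" "w = [b]" using assms Opt by auto
    then have "B - {c. b \<le> c} \<subset> B" by auto
    then have "card (B - {c. b \<le> c}) < card B" using B(1) by (rule psubset_card_mono[rotated])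
    then have "(rank [Opt (B - {c. b \<le> c})], atom_rank X) \<in> cnf_less"
      by (intro cnf_lessI[OF finite_rank finite_atom_rank, where n = 0])
        (use Opt in \<open>auto simp: rank_Cons\<close>)
    moreover have "u \<in> lang [Opt (B - {c. b \<le> c})]"
      if u: "u \<in> atom_lang X" "\<not> list_emb (\<le>) w u" for u
    proof -
      from u(1) Opt consider "u = []" | c where "u = [c]" "c \<in> B"
        by (cases u) auto
      then show ?thesis using u(2) b by cases auto
    qed
    ultimately show ?thesis using that[of "[Opt (B - {c. b \<le> c})]"] good_atom_remove[OF B] by auto
  qed
qed

text \<open>If \<open>v @ v'\<close> does not embed in \<open>x @ y\<close>, then \<open>v\<close>
  does not embed in \<open>x\<close> or \<open>v'\<close> does not embed in \<open>y\<close>. Each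
  alternative replaces one part of the product by something of smaller rank, and the natural sum
  decreases strictly.\<close>

lemma lang_peel:
  assumes "good p" "w \<in> lang p"
  shows "\<exists>Q. finite Q \<and> (\<forall>q\<in>Q. good q \<and> (rank q, rank p) \<in> cnf_less) \<and>
    (\<forall>u\<in>lang p. \<not> list_emb (\<le>) w u \<longrightarrow> (\<exists>q\<in>Q. u \<in> lang q))"
  using assms
proof (induction p arbitrary: w)
  case Nil
  then show ?case by (intro exI[of _ "{}"]) auto
next
  case (Cons X p)
  then obtain v v' where w: "w = v @ v'" "v \<in> atom_lang X" "v' \<in> lang p" by auto
  from Cons.prems have X: "good_atom X" and p: "good p" by auto
  from Cons.IH[OF p w(3)] obtain Q where Q: "finite Q"
    "\<forall>q\<in>Q. good q \<and> (rank q, rank p) \<in> cnf_less"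
    "\<forall>u\<in>lang p. \<not> list_emb (\<le>) v' u \<longrightarrow> (\<exists>q\<in>Q. u \<in> lang q)" by blast
  obtain q1 where q1: "good q1" "(rank q1, atom_rank X) \<in> cnf_less"
    "\<And>u. u \<in> atom_lang X \<Longrightarrow> \<not> list_emb (\<le>) v u \<Longrightarrow> u \<in> lang q1"
    using atom_peel[OF X w(2)] by blast
  show ?case
  proof (intro exI[of _ "insert (q1 @ p) ((#) X ` Q)"] conjI ballI impI)
    fix q assume "q \<in> insert (q1 @ p) ((#) X ` Q)"
    then show "good q" "(rank q, rank (X # p)) \<in> cnf_less"
      using Q(2) q1 X p cnf_less_add_right[OF q1(2) finite_rank[of p]]
        cnf_less_add_left[OF _ finite_atom_rank[of X]]
      by (auto simp: rank_Cons rank_append)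
  next
    fix u assume "u \<in> lang (X # p)" and not: "\<not> list_emb (\<le>) w u"
    then obtain x y where u: "u = x @ y" "x \<in> atom_lang X" "y \<in> lang p" by auto
    show "\<exists>q\<in>insert (q1 @ p) ((#) X ` Q). u \<in> lang q"
    proof (cases "list_emb (\<le>) v x")
      case True
      then have "\<not> list_emb (\<le>) v' y" using not u(1) w(1) list_emb_append_mono by blast
      with Q(3) u(3) obtain q where "q \<in> Q" "y \<in> lang q" by blast
      then show ?thesis using u(1,2) by auto
    next
      case False
      then show ?thesis using q1(3)[OF u(2)] lang_append[OF _ u(3)] u(1) by blast
    qed
  qed (use Q(1) in simp)
qed

section \<open>Heights and well-quasi-orders by peeling\<close>

lemma wf_cnf_less: "wf cnf_less"
  unfolding cnf_less_def by (rule wf_omega_pow_omega)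

lemma cnf_not_less_less_trans:
  assumes "(g, f) \<notin> cnf_less" "(g, h) \<in> cnf_less" "finite {n. f n \<noteq> 0}"
  shows "(f, h) \<in> cnf_less"
proof -
  have wo: "trans omega_pow_omega" "antisym omega_pow_omega"
    "total_on (Field omega_pow_omega) omega_pow_omega"
    using Well_order_omega_pow_omega by (auto simp: order_on_defs)
  have "g \<in> Field omega_pow_omega" "f \<in> Field omega_pow_omega"
    using assms by (auto simp: cnf_less_def Field_omega_pow_omega dest: FieldI1)
  then have "f = g \<or> (f, g) \<in> cnf_less"
    using assms(1) wo(3) unfolding total_on_def cnf_less_def by blast
  then show ?thesis
    using assms(2) wo(1,2) unfolding cnf_less_def
    by (metis DiffD1 DiffD2 DiffI antisymD pair_in_Id_conv transD)
qed

text \<open>Countability lets initial segments of \<omega>^\<omega> be copied to \<open>nat\<close>,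
  so that heights exist as orders of type \<open>nat rel\<close>. A finitely supported function is
  recovered from the list of its first values.\<close>

lemma countable_omega_pow_omega: "countable (Field omega_pow_omega)"
proof (rule countable_subset)
  show "Field omega_pow_omega \<subseteq> range (\<lambda>(xs :: nat list) n. if n < length xs then xs ! n else 0)"
  proof
    fix f :: "nat \<Rightarrow> nat" assume "f \<in> Field omega_pow_omega"
    then have "finite {n. f n \<noteq> 0}" by (simp add: Field_omega_pow_omega)
    then obtain N where N: "\<And>n. f n \<noteq> 0 \<Longrightarrow> n < N"
      unfolding finite_nat_set_iff_bounded by blast
    have "f n = (if n < length (map f [0..<N]) then map f [0..<N] ! n else 0)" for n
      using N[of n] by auto
    then have "f = (\<lambda>n. if n < length (map f [0..<N]) then map f [0..<N] ! n else 0)" ..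
    then show "f \<in> range (\<lambda>(xs :: nat list) n. if n < length xs then xs ! n else 0)" by blast
  qed
qed simp

text \<open>\<open>W y\<close> is a copy on \<open>nat\<close> of the segment below the rank of
  \<open>y\<close>. Heights are only bounded by these copies, as ranks may skip values; the copies
  serve as upper bounds from which the least one is taken.\<close>

lemma wf_has_height_cnf:
  fixes lt :: "'b \<Rightarrow> 'b \<Rightarrow> bool" and \<phi> :: "'b \<Rightarrow> nat \<Rightarrow> nat"
  assumes mono: "\<And>x y. x \<in> P \<Longrightarrow> y \<in> P \<Longrightarrow> lt y x \<Longrightarrow> (\<phi> y, \<phi> x) \<in> cnf_less"
    and "x \<in> P"
  shows "\<exists>\<alpha> :: nat rel. has_height lt P x \<alpha> \<and> (\<alpha>, omega_pow_omega) \<in> ordLess"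
proof -
  let ?w = omega_pow_omega
  note wo = Well_order_omega_pow_omega
  obtain k :: "(nat \<Rightarrow> nat) \<Rightarrow> nat" where k: "inj_on k (Field ?w)"
    using countable_omega_pow_omega unfolding countable_def by blast
  define seg where "seg y = Restr ?w (underS ?w (\<phi> y))" for y
  define W where "W y = dir_image (seg y) k" for y
  have seg_wo: "Well_order (seg y)" for y
    unfolding seg_def by (rule Well_order_Restr[OF wo])
  have "inj_on k (Field (seg y))" for y
    using k by (rule inj_on_subset) (auto simp: seg_def Field_def)
  then have W: "(seg y, W y) \<in> ordIso" for y
    unfolding W_def by (intro dir_image_ordIso seg_wo)
  have W_wo: "Well_order (W y)" for y using W[of y] unfolding ordIso_def by auto
  have W_less: "(W y, W x) \<in> ordLess" if "x \<in> P" "y \<in> P" "lt y x" for x y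
  proof -
    have xy: "(\<phi> y, \<phi> x) \<in> ?w" "\<phi> y \<noteq> \<phi> x" using mono[OF that] by (auto simp: cnf_less_def)
    have "trans ?w" "antisym ?w" using wo by (auto simp: order_on_defs)
    then have "underS ?w (\<phi> y) \<subseteq> underS ?w (\<phi> x)" using underS_incr xy(1) by metis
    moreover have "\<phi> y \<in> underS ?w (\<phi> x)" "\<phi> y \<notin> underS ?w (\<phi> y)"
      using xy by (auto simp: underS_def)
    ultimately have "underS ?w (\<phi> y) \<subset> underS ?w (\<phi> x)" by blast
    then have "(seg y, seg x) \<in> ordLess" unfolding seg_def
      using ofilter_subset_ordLess[OF wo] wo_rel.underS_ofilter[of ?w] wo
      by (simp add: wo_rel_def)
    then show ?thesis using W ordIso_symmetric ordIso_ordLess_trans ordLess_ordIso_trans by metis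
  qed
  have "\<exists>\<alpha> :: nat rel. has_height lt P x \<alpha> \<and> (\<alpha>, W x) \<in> ordLeq" if "x \<in> P" for x
    using that
  proof (induction x rule: wf_induct_rule[OF wf_inv_image[OF wf_cnf_less, of \<phi>]])
    case (1 x)
    have "\<forall>y. \<exists>\<alpha> :: nat rel. y \<in> P \<and> lt y x \<longrightarrow> has_height lt P y \<alpha> \<and> (\<alpha>, W y) \<in> ordLeq"
      using 1 mono by (metis in_inv_image)
    then obtain h :: "'b \<Rightarrow> nat rel" where
      h: "\<And>y. y \<in> P \<Longrightarrow> lt y x \<Longrightarrow> has_height lt P y (h y)"
        "\<And>y. y \<in> P \<Longrightarrow> lt y x \<Longrightarrow> (h y, W y) \<in> ordLeq" by metis
    \<comment> \<open>The candidates for the supremum: \<open>W x\<close> is among them, so a least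
      one exists, and it is the height of \<open>x\<close>.\<close>
    let ?R = "{\<beta> :: nat rel. Well_order \<beta> \<and> (\<forall>y. y \<in> P \<longrightarrow> lt y x \<longrightarrow> (h y, \<beta>) \<in> ordLess)}"
    have Wx: "W x \<in> ?R" using W_wo h(2) W_less[OF 1(2)] ordLeq_ordLess_trans by blast
    then have "?R \<noteq> {}" "\<forall>r\<in>?R. Well_order r" by blast+
    from exists_minim_Well_order[OF this] obtain \<alpha> where \<alpha>: "\<alpha> \<in> ?R" "\<forall>r\<in>?R. (\<alpha>, r) \<in> ordLeq"
      by blast
    have "has_height lt P x \<alpha>"
      by (rule has_height.intros[of x P lt h]) (use 1(2) h(1) \<alpha> in auto)
    then show ?case using \<alpha>(2) Wx by blast
  qed
  then obtain \<alpha> :: "nat rel" where \<alpha>: "has_height lt P x \<alpha>" "(\<alpha>, W x) \<in> ordLeq"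
    using assms(2) by blast
  have "(seg x, ?w) \<in> ordLess" unfolding seg_def
    \<comment> \<open>The zero function shows that the field of \<omega>^\<omega> is
      nonempty.\<close>
    by (rule underS_Restr_ordLess[OF wo]) (auto simp: Field_omega_pow_omega intro!: exI[of _ "\<lambda>_. 0"])
  then have "(W x, ?w) \<in> ordLess" using W ordIso_symmetric ordIso_ordLess_trans by metis
  with \<alpha> show ?thesis using ordLeq_ordLess_trans by blast
qed

text \<open>Isolates what both claims use. The members of \<open>Q\<close> only have to cover the
  points not above \<open>t\<close>, so the remaining set never has to be described exactly.\<close>

locale peeling =
  fixes le :: "'b \<Rightarrow> 'b \<Rightarrow> bool" and P :: "'b set" and K :: "'k set"
    and D :: "'k \<Rightarrow> 'b set" and rk :: "'k \<Rightarrow> nat \<Rightarrow> nat"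
  assumes finite_rk: "k \<in> K \<Longrightarrow> finite {n. rk k n \<noteq> 0}"
    and downward: "\<lbrakk>k \<in> K; x \<in> D k; y \<in> P; le y x\<rbrakk> \<Longrightarrow> y \<in> D k"
    and peel: "\<lbrakk>k \<in> K; t \<in> D k\<rbrakk> \<Longrightarrow> \<exists>Q\<subseteq>K. finite Q \<and> (\<forall>q\<in>Q. (rk q, rk k) \<in> cnf_less) \<and>
      (\<forall>u\<in>D k. \<not> le t u \<longrightarrow> (\<exists>q\<in>Q. u \<in> D q))"
begin

text \<open>In a bad sequence no later term lies above the first, so all later terms fall into
  finitely many members of smaller rank. The pigeonhole principle puts a subsequence into one of
  them, and it is again bad.\<close>

lemma good_sequence:
  assumes "k \<in> K" "\<And>n :: nat. s n \<in> D k"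
  shows "\<exists>i j. i < j \<and> le (s i) (s j)"
  using assms
proof (induction k arbitrary: s rule: wf_induct_rule[OF wf_inv_image[OF wf_cnf_less, of rk]])
  case (1 k)
  show ?case
  proof (rule ccontr)
    assume bad: "\<not> ?thesis"
    from peel[OF 1(2) 1(3)[of 0]] obtain Q where Q: "Q \<subseteq> K" "finite Q"
      "\<And>q. q \<in> Q \<Longrightarrow> (rk q, rk k) \<in> cnf_less"
      "\<And>u. u \<in> D k \<Longrightarrow> \<not> le (s 0) u \<Longrightarrow> \<exists>q\<in>Q. u \<in> D q" by metis
    have "\<forall>n. \<exists>q\<in>Q. s (Suc n) \<in> D q" using Q(4) 1(3) bad by blast
    then obtain c where c: "\<And>n. c n \<in> Q" "\<And>n. s (Suc n) \<in> D (c n)" by metis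
    have "finite (range c)" using c(1) Q(2) by (meson finite_subset image_subsetI)
    then obtain n0 where inf: "infinite {n. c n = c n0}"
      using pigeonhole_infinite[of UNIV c] by auto
    \<comment> \<open>\<open>e\<close> enumerates the indices sharing one member of
      \<open>Q\<close>; the shift by \<open>Suc\<close> is due to term 0, which was peeled
      off.\<close>
    define e where "e = enumerate {n. c n = c n0}"
    have e: "strict_mono e" "\<And>n. c (e n) = c n0"
      unfolding e_def using strict_mono_enumerate[OF inf] enumerate_in_set[OF inf] by auto
    have "s (Suc (e n)) \<in> D (c n0)" for n using c(2)[of "e n"] e(2)[of n] by simp
    moreover have "(c n0, k) \<in> inv_image cnf_less rk" using Q(3) c(1) by simp
    ultimately obtain i j where "i < j" "le (s (Suc (e i))) (s (Suc (e j)))"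
      using 1(1)[of "c n0" "\<lambda>n. s (Suc (e n))"] Q(1) c(1) by blast
    with bad e(1) show False by (meson Suc_mono strict_monoD)
  qed
qed

text \<open>By directedness, a point outside \<open>D q\<close> and a point outside all other
  members have a common upper bound in the ideal. As the members are down-sets, it would lie in none
  of them.\<close>

lemma ideal_covered:
  assumes J: "order_ideal le P J" and Q: "finite Q" "Q \<subseteq> K" "\<And>x. x \<in> J \<Longrightarrow> \<exists>q\<in>Q. x \<in> D q"
  shows "\<exists>q\<in>Q. J \<subseteq> D q"
  using Q
proof (induction Q rule: finite_induct)
  case empty
  then show ?case using J by (auto simp: order_ideal_def)
next
  case (insert q Q)
  show ?case
  proof (rule ccontr)
    assume not: "\<not> ?thesis"
    then obtain x where x: "x \<in> J" "x \<notin> D q" by blast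
    \<comment> \<open>If \<open>Q\<close> alone covered \<open>J\<close>, the induction hypothesis
      would put \<open>J\<close> into one of its members.\<close>
    obtain y where y: "y \<in> J" "\<And>q. q \<in> Q \<Longrightarrow> y \<notin> D q" using insert not by blast
    obtain z where z: "z \<in> J" "le x z" "le y z" using J x(1) y(1) unfolding order_ideal_def by blast
    obtain q' where "q' \<in> insert q Q" "z \<in> D q'" using insert.prems(2) z(1) by blast
    moreover have "x \<in> P" "y \<in> P" using J x y by (auto simp: order_ideal_def)
    ultimately show False using downward z(2,3) x(2) y(2) insert.prems(1) by blast
  qed
qed

text \<open>The rank of an ideal is the least rank of a member containing it. It is strictly monotone:
  if \<open>J'\<close> is contained in a member of minimal rank and \<open>J\<close> omits a point \<open>t\<close> of \<open>J'\<close>, then peeling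
  off \<open>t\<close> covers \<open>J\<close> by members of smaller rank, one of which contains \<open>J\<close>.\<close>

lemma ideal_height:
  assumes "order_ideal le P A" "k0 \<in> K" "A \<subseteq> D k0"
  shows "\<exists>\<alpha> :: nat rel. has_height (\<subset>) {J. order_ideal le P J \<and> J \<subseteq> A} A \<alpha> \<and>
    (\<alpha>, omega_pow_omega) \<in> ordLess"
proof -
  let ?P = "{J. order_ideal le P J \<and> J \<subseteq> A}"
  have "\<forall>J\<in>?P. \<exists>k. (k \<in> K \<and> J \<subseteq> D k) \<and> (\<forall>k'\<in>K. J \<subseteq> D k' \<longrightarrow> (rk k', rk k) \<notin> cnf_less)"
  proof
    fix J assume "J \<in> ?P"
    then have "k0 \<in> {k\<in>K. J \<subseteq> D k}" using assms by blast
    from wfE_min[OF wf_inv_image[OF wf_cnf_less, of rk] this] obtain k where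
      "k \<in> {k\<in>K. J \<subseteq> D k}" "\<And>k'. (k', k) \<in> inv_image cnf_less rk \<Longrightarrow> k' \<notin> {k\<in>K. J \<subseteq> D k}"
      by blast
    then show "\<exists>k. (k \<in> K \<and> J \<subseteq> D k) \<and> (\<forall>k'\<in>K. J \<subseteq> D k' \<longrightarrow> (rk k', rk k) \<notin> cnf_less)"
      by (intro exI[of _ k]) (simp; blast)
  qed
  from bchoice[OF this] obtain \<kappa> where
    \<kappa>': "\<forall>J\<in>?P. (\<kappa> J \<in> K \<and> J \<subseteq> D (\<kappa> J)) \<and> (\<forall>k'\<in>K. J \<subseteq> D k' \<longrightarrow> (rk k', rk (\<kappa> J)) \<notin> cnf_less)"
    by (rule exE)
  then have \<kappa>: "\<And>J. J \<in> ?P \<Longrightarrow> \<kappa> J \<in> K" "\<And>J. J \<in> ?P \<Longrightarrow> J \<subseteq> D (\<kappa> J)"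
    and least: "\<And>J k'. J \<in> ?P \<Longrightarrow> k' \<in> K \<Longrightarrow> J \<subseteq> D k' \<Longrightarrow> (rk k', rk (\<kappa> J)) \<notin> cnf_less"
    by blast+
  have "(rk (\<kappa> J), rk (\<kappa> J')) \<in> cnf_less" if J: "J' \<in> ?P" "J \<in> ?P" "J \<subset> J'" for J J'
  proof -
    obtain t where t: "t \<in> J'" "t \<notin> J" using J(3) by blast
    from peel[OF \<kappa>(1)[OF J(1)], of t] obtain Q where Q: "Q \<subseteq> K" "finite Q"
      "\<And>q. q \<in> Q \<Longrightarrow> (rk q, rk (\<kappa> J')) \<in> cnf_less"
      "\<And>u. u \<in> D (\<kappa> J') \<Longrightarrow> \<not> le t u \<Longrightarrow> \<exists>q\<in>Q. u \<in> D q"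
      using \<kappa>(2)[OF J(1)] t(1) by blast
    have "\<not> le t u" if "u \<in> J" for u
    proof -
      have "t \<in> P" using J(1) t(1) by (auto simp: order_ideal_def)
      then show ?thesis using J(2) that t(2) by (auto simp: order_ideal_def)
    qed
    then have cover: "\<exists>q\<in>Q. u \<in> D q" if "u \<in> J" for u
      using Q(4)[of u] \<kappa>(2)[OF J(1)] J(3) that by auto
    have "order_ideal le P J" using J(2) by simp
    from ideal_covered[OF this Q(2,1) cover] obtain q where q: "q \<in> Q" "J \<subseteq> D q" by blast
    \<comment> \<open>The least rank for \<open>J\<close> is at most that of \<open>q\<close>, which
      is below the least rank for \<open>J'\<close>.\<close>
    have "(rk q, rk (\<kappa> J)) \<notin> cnf_less" using least[OF J(2)] q Q(1) by blast
    then show ?thesis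
      using cnf_not_less_less_trans[of "rk q" "rk (\<kappa> J)"] Q(3)[OF q(1)] finite_rk[OF \<kappa>(1)[OF J(2)]]
      by blast
  qed
  from wf_has_height_cnf[of ?P "(\<subset>)" "\<lambda>J. rk (\<kappa> J)", OF this] show ?thesis
    using assms(1) by simp
qed

end

section \<open>Isomorphism types and ages\<close>

lemma is_iso_id: "is_iso \<mu> S S id"
  by (simp add: is_iso_def)

lemma is_iso_comp:
  assumes "is_iso \<mu> S T f" "is_iso \<mu> T U g"
  shows "is_iso \<mu> S U (g \<circ> f)"
  unfolding is_iso_def
proof (intro conjI ballI allI impI)
  show "bij_betw (g \<circ> f) (universe S) (universe U)"
    using assms by (auto simp: is_iso_def intro: bij_betw_trans)
  fix i xs assume i: "i \<in> idx \<mu>" and xs: "length xs = arity \<mu> i \<and> set xs \<subseteq> universe S"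
  have "set (map f xs) \<subseteq> universe T"
    using assms(1) xs by (auto simp: is_iso_def bij_betw_def)
  then show "(xs \<in> rel S i) = (map (g \<circ> f) xs \<in> rel U i)"
    using assms i xs by (simp add: is_iso_def flip: map_map)
qed

lemma is_iso_inv:
  assumes "is_iso \<mu> S T f"
  shows "is_iso \<mu> T S (the_inv_into (universe S) f)"
  unfolding is_iso_def
proof (intro conjI ballI allI impI)
  let ?g = "the_inv_into (universe S) f"
  have f: "bij_betw f (universe S) (universe T)" using assms by (simp add: is_iso_def)
  then show g: "bij_betw ?g (universe T) (universe S)" by (rule bij_betw_the_inv_into)
  fix i xs assume i: "i \<in> idx \<mu>" and xs: "length xs = arity \<mu> i \<and> set xs \<subseteq> universe T"
  have "set (map ?g xs) \<subseteq> universe S" using bij_betwE[OF g] xs by auto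
  moreover have "map f (map ?g xs) = xs"
    unfolding map_map by (rule map_idI) (use f xs f_the_inv_into_f_bij_betw in fastforce)
  ultimately show "(xs \<in> rel T i) = (map ?g xs \<in> rel S i)"
    using assms i xs unfolding is_iso_def by (metis length_map)
qed

lemma isomorphic_refl: "isomorphic \<mu> S S"
  and isomorphic_sym: "isomorphic \<mu> S T \<Longrightarrow> isomorphic \<mu> T S"
  and isomorphic_trans: "isomorphic \<mu> S T \<Longrightarrow> isomorphic \<mu> T U \<Longrightarrow> isomorphic \<mu> S U"
  unfolding isomorphic_def by (blast intro: is_iso_id is_iso_inv is_iso_comp)+

lemma universe_induced [simp]: "universe (induced S A) = A"
  and rel_induced [simp]: "rel (induced S A) i = {xs \<in> rel S i. set xs \<subseteq> A}"
  by (simp_all add: induced_def)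

lemma structure_of_induced: "structure_of \<mu> S \<Longrightarrow> structure_of \<mu> (induced S A)"
  by (fastforce simp: structure_of_def)

lemma induced_induced: "B \<subseteq> A \<Longrightarrow> induced (induced S A) B = induced S B"
  by (auto simp: induced_def)

lemma is_iso_induced:
  assumes "is_iso \<mu> S T f" "A \<subseteq> universe S"
  shows "is_iso \<mu> (induced S A) (induced T (f ` A)) f"
  unfolding is_iso_def
proof (intro conjI ballI allI impI)
  show "bij_betw f (universe (induced S A)) (universe (induced T (f ` A)))"
    using assms by (auto simp: is_iso_def bij_betw_def intro: inj_on_subset)
  fix i xs assume "i \<in> idx \<mu>" "length xs = arity \<mu> i \<and> set xs \<subseteq> universe (induced S A)"
  then show "(xs \<in> rel (induced S A) i) = (map f xs \<in> rel (induced T (f ` A)) i)"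
    using assms by (auto simp: is_iso_def)
qed

lemma isomorphic_induced:
  assumes "isomorphic \<mu> S T" "A \<subseteq> universe S"
  shows "\<exists>B\<subseteq>universe T. isomorphic \<mu> (induced S A) (induced T B)"
proof -
  obtain f where f: "is_iso \<mu> S T f" using assms(1) by (auto simp: isomorphic_def)
  have "f ` A \<subseteq> universe T" using f assms(2) by (auto simp: is_iso_def bij_betw_def)
  then show ?thesis using is_iso_induced[OF f assms(2)] by (auto simp: isomorphic_def)
qed

lemma isomorphic_finite:
  "isomorphic \<mu> S T \<Longrightarrow> finite (universe S) \<longleftrightarrow> finite (universe T)"
  by (auto simp: isomorphic_def is_iso_def dest: bij_betw_finite)

lemma iso_type_eqI:
  assumes "isomorphic \<mu> S T"
  shows "iso_type \<mu> S = iso_type \<mu> T"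
  unfolding iso_type_def
  using isomorphic_trans[OF assms] isomorphic_trans[OF isomorphic_sym[OF assms]] by auto

text \<open>\<open>type_le\<close> looks for representatives on \<open>nat\<close>; without a copy
  there, the type of a structure on another carrier would be empty.\<close>

lemma iso_type_nonempty:
  fixes S :: "('a, 'i) rel_structure"
  assumes "structure_of \<mu> S" "finite (universe S)"
  obtains T where "T \<in> iso_type \<mu> S"
proof -
  obtain f :: "'a \<Rightarrow> nat" where f: "inj_on f (universe S)"
    using finite_imp_inj_to_nat_seg[OF assms(2)] by blast
  define T :: "(nat, 'i) rel_structure" where
    "T = \<lparr>universe = f ` universe S, rel = \<lambda>i. map f ` {xs \<in> rel S i. set xs \<subseteq> universe S}\<rparr>"
  have "structure_of \<mu> T" using assms(1) by (fastforce simp: structure_of_def T_def)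
  moreover have "is_iso \<mu> S T f"
    unfolding is_iso_def
  proof (intro conjI ballI allI impI)
    show "bij_betw f (universe S) (universe T)" using f by (simp add: bij_betw_def T_def)
    fix i xs assume "i \<in> idx \<mu>" and xs: "length xs = arity \<mu> i \<and> set xs \<subseteq> universe S"
    have "xs = ys" if "map f xs = map f ys" "set ys \<subseteq> universe S" for ys
      using that xs f by (meson inj_on_map_eq_map inj_on_subset Un_least)
    then show "(xs \<in> rel S i) = (map f xs \<in> rel T i)" using xs by (auto simp: T_def)
  qed
  ultimately show ?thesis using that by (auto simp: iso_type_def isomorphic_def)
qed

lemma iso_type_in_Omega:
  assumes "structure_of \<mu> S" "finite (universe S)"
  shows "iso_type \<mu> S \<in> Omega \<mu>"
proof -
  obtain T where T: "T \<in> iso_type \<mu> S" using iso_type_nonempty[OF assms] .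
  then have "isomorphic \<mu> S T" "structure_of \<mu> T" by (auto simp: iso_type_def)
  then show ?thesis using iso_type_eqI isomorphic_finite assms(2) unfolding Omega_def by blast
qed

lemma type_le_iff:
  fixes S :: "('a, 'i) rel_structure" and T :: "('b, 'i) rel_structure"
  assumes S: "structure_of \<mu> S" "finite (universe S)" and T: "structure_of \<mu> T" "finite (universe T)"
  shows "type_le \<mu> (iso_type \<mu> S) (iso_type \<mu> T) \<longleftrightarrow> embeds \<mu> S T"
proof
  assume "type_le \<mu> (iso_type \<mu> S) (iso_type \<mu> T)"
  then obtain S' T' :: "(nat, 'i) rel_structure" and B where *: "isomorphic \<mu> S S'" "isomorphic \<mu> T T'" "B \<subseteq> universe T'"
    "isomorphic \<mu> S' (induced T' B)"
    by (auto simp: type_le_def iso_type_def embeds_def)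
  obtain C where C: "C \<subseteq> universe T" "isomorphic \<mu> (induced T' B) (induced T C)"
    using isomorphic_induced[OF isomorphic_sym[OF *(2)] *(3)] by auto
  show "embeds \<mu> S T" unfolding embeds_def
    using C(1) isomorphic_trans[OF *(1) isomorphic_trans[OF *(4) C(2)]] by auto
next
  assume "embeds \<mu> S T"
  then obtain B where B: "B \<subseteq> universe T" "isomorphic \<mu> S (induced T B)" by (auto simp: embeds_def)
  obtain S' where S': "S' \<in> iso_type \<mu> S" using iso_type_nonempty[OF S] .
  obtain T' where T': "T' \<in> iso_type \<mu> T" using iso_type_nonempty[OF T] .
  then have "isomorphic \<mu> T T'" by (simp add: iso_type_def)
  from isomorphic_induced[OF this B(1)] obtain C where
    C: "C \<subseteq> universe T'" "isomorphic \<mu> (induced T B) (induced T' C)" by auto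
  have S: "isomorphic \<mu> S' S" by (rule isomorphic_sym) (use S' in \<open>simp add: iso_type_def\<close>)
  have "embeds \<mu> S' T'" unfolding embeds_def
    using C(1) isomorphic_trans[OF S isomorphic_trans[OF B(2) C(2)]] by auto
  then show "type_le \<mu> (iso_type \<mu> S) (iso_type \<mu> T)" using S' T' by (auto simp: type_le_def)
qed

text \<open>The image of an embedding is a subset of \<open>A\<close>, so comparison of types
  becomes passage to a subset. Down-closure and minimality are both reduced to this.\<close>

lemma below_age_member:
  fixes R :: "('a, 'i) rel_structure"
  assumes R: "structure_of \<mu> R" and A: "finite A" and y: "y \<in> Omega \<mu>"
    and le: "type_le \<mu> y (iso_type \<mu> (induced R A))"
  obtains B where "B \<subseteq> A" "y = iso_type \<mu> (induced R B)"
proof -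
  obtain S :: "(nat, 'i) rel_structure" where S: "y = iso_type \<mu> S" "structure_of \<mu> S" "finite (universe S)"
    using y by (auto simp: Omega_def)
  then have "embeds \<mu> S (induced R A)"
    using le A by (simp add: type_le_iff structure_of_induced[OF R])
  then obtain B where "B \<subseteq> A" "isomorphic \<mu> S (induced R B)"
    by (auto simp: embeds_def induced_induced)
  then show ?thesis using that S(1) iso_type_eqI by blast
qed

lemma age_subset_Omega: "structure_of \<mu> R \<Longrightarrow> age \<mu> R \<subseteq> Omega \<mu>"
  by (auto simp: age_def intro!: iso_type_in_Omega structure_of_induced)

lemma type_le_subset:
  assumes "structure_of \<mu> R" "A \<subseteq> B" "finite B"
  shows "type_le \<mu> (iso_type \<mu> (induced R A)) (iso_type \<mu> (induced R B))"
proof -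
  have "embeds \<mu> (induced R A) (induced R B)"
    unfolding embeds_def using assms(2) isomorphic_refl
    by (intro exI[of _ A]) (simp add: induced_induced)
  then show ?thesis
    using finite_subset[OF assms(2,3)] assms(1,3) by (simp add: type_le_iff structure_of_induced)
qed

lemma order_ideal_age:
  assumes R: "structure_of \<mu> R"
  shows "order_ideal (type_le \<mu>) (Omega \<mu>) (age \<mu> R)"
  unfolding order_ideal_def
proof (intro conjI ballI impI)
  show "age \<mu> R \<subseteq> Omega \<mu>" by (rule age_subset_Omega[OF R])
  show "age \<mu> R \<noteq> {}" unfolding age_def by blast
next
  fix x y assume "x \<in> age \<mu> R" "y \<in> Omega \<mu>" "type_le \<mu> y x"
  then obtain A where "finite A" "A \<subseteq> universe R" "type_le \<mu> y (iso_type \<mu> (induced R A))"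
    unfolding age_def by blast
  with below_age_member[OF R _ \<open>y \<in> Omega \<mu>\<close>] obtain B where
    "B \<subseteq> A" "y = iso_type \<mu> (induced R B)" by metis
  then show "y \<in> age \<mu> R"
    using \<open>finite A\<close> \<open>A \<subseteq> universe R\<close> finite_subset unfolding age_def by blast
next
  fix x y assume "x \<in> age \<mu> R" "y \<in> age \<mu> R"
  then obtain A B where AB: "x = iso_type \<mu> (induced R A)" "y = iso_type \<mu> (induced R B)"
    "finite A" "finite B" "A \<subseteq> universe R" "B \<subseteq> universe R" by (auto simp: age_def)
  have "iso_type \<mu> (induced R (A \<union> B)) \<in> age \<mu> R" using AB by (auto simp: age_def)
  moreover have "type_le \<mu> x (iso_type \<mu> (induced R (A \<union> B)))"
    "type_le \<mu> y (iso_type \<mu> (induced R (A \<union> B)))"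
    using AB type_le_subset[OF R, of _ "A \<union> B"] by auto
  ultimately show "\<exists>z\<in>age \<mu> R. type_le \<mu> x z \<and> type_le \<mu> y z" by blast
qed

text \<open>Infinitely many minimal elements would form a bad sequence, since comparable minimal
  elements are equal. Existence has another source: a set with the fewest points among those whose
  type is in \<open>X\<close> has a minimal type.\<close>

lemma well_quasi_ordered_age:
  assumes R: "structure_of \<mu> R"
    and seq: "\<And>s :: nat \<Rightarrow> _. (\<And>n. s n \<in> age \<mu> R) \<Longrightarrow> \<exists>i j. i < j \<and> type_le \<mu> (s i) (s j)"
  shows "well_quasi_ordered (type_le \<mu>) (age \<mu> R)"
  unfolding well_quasi_ordered_def
proof (intro allI impI conjI)
  fix X assume X: "X \<subseteq> age \<mu> R \<and> X \<noteq> {}"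
  show "finite (minimal_elements (type_le \<mu>) X)"
  proof (rule ccontr)
    assume "infinite (minimal_elements (type_le \<mu>) X)"
    then obtain s :: "nat \<Rightarrow> _" where s: "inj s" "range s \<subseteq> minimal_elements (type_le \<mu>) X"
      using infinite_countable_subset by blast
    then have min: "s n \<in> X" "y \<in> X \<Longrightarrow> type_le \<mu> y (s n) \<Longrightarrow> y = s n" for n y
      by (auto simp: minimal_elements_def image_subset_iff)
    then obtain i j where "i < j" "type_le \<mu> (s i) (s j)" using seq[of s] X by blast
    then have "s i = s j" using min by blast
    with \<open>i < j\<close> s(1) show False by (auto simp: inj_eq)
  qed
  define \<A> where "\<A> = {A. finite A \<and> iso_type \<mu> (induced R A) \<in> X}"
  obtain A\<^sub>0 where "A\<^sub>0 \<in> \<A>" using X by (auto simp: age_def \<A>_def)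
  then obtain A where A: "A \<in> \<A>" "\<And>B. B \<in> \<A> \<Longrightarrow> card A \<le> card B"
    using ex_has_least_nat[of "\<lambda>A. A \<in> \<A>" A\<^sub>0 card] by blast
  have "iso_type \<mu> (induced R A) \<in> minimal_elements (type_le \<mu>) X"
    unfolding minimal_elements_def
  proof (intro CollectI conjI ballI impI)
    show "iso_type \<mu> (induced R A) \<in> X" using A(1) by (simp add: \<A>_def)
    fix y assume y: "y \<in> X" "type_le \<mu> y (iso_type \<mu> (induced R A))"
    have "y \<in> Omega \<mu>" using y(1) X age_subset_Omega[OF R] by blast
    moreover have "finite A" using A(1) by (simp add: \<A>_def)
    ultimately obtain B where B: "B \<subseteq> A" "y = iso_type \<mu> (induced R B)"
      using below_age_member[OF R _ _ y(2)] by blast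
    then have "B \<in> \<A>" using \<open>finite A\<close> y(1) by (auto simp: \<A>_def intro: finite_subset)
    then have "B = A" using A(2) B(1) \<open>finite A\<close> by (meson card_seteq)
    then show "y = iso_type \<mu> (induced R A)" using B(2) by simp
  qed
  then show "minimal_elements (type_le \<mu>) X \<noteq> {}" by blast
qed

lemma well_quasi_ordered_subset:
  "well_quasi_ordered le P \<Longrightarrow> P' \<subseteq> P \<Longrightarrow> well_quasi_ordered le P'"
  unfolding well_quasi_ordered_def by (meson subset_trans)

section \<open>Coding finite parts by words\<close>

text \<open>Reads off the positions used by a word embedding. With \<open>ys'\<close> an increasing
  list in \<open>L\<close>, the subsequence \<open>zs\<close> is the target of the local isomorphism
  in \<open>codes_embeds\<close>.\<close>

lemma list_emb_positions:
  assumes "list_emb P ws ws'" "length ys' = length ws'"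
  shows "\<exists>zs. subseq zs ys' \<and> length zs = length ws \<and>
    (\<forall>i<length ws. \<exists>j<length ws'. zs ! i = ys' ! j \<and> P (ws ! i) (ws' ! j))"
  using assms
proof (induction arbitrary: ys' rule: list_emb.induct)
  case (list_emb_Nil ws')
  then show ?case by (intro exI[of _ "[]"]) simp
next
  case (list_emb_Cons ws ws' X)
  then obtain y ys where ys: "ys' = y # ys" "length ys = length ws'" by (auto simp: length_Suc_conv)
  from list_emb_Cons.IH[OF ys(2)] obtain zs where zs: "subseq zs ys" "length zs = length ws"
    "\<forall>i<length ws. \<exists>j<length ws'. zs ! i = ys ! j \<and> P (ws ! i) (ws' ! j)" by blast
  show ?case
  proof (intro exI[of _ zs] conjI allI impI)
    show "subseq zs ys'" unfolding ys(1) using zs(1) by (rule list_emb.list_emb_Cons)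
    fix i assume "i < length ws"
    with zs(3) obtain j where "j < length ws'" "zs ! i = ys ! j" "P (ws ! i) (ws' ! j)" by blast
    then show "\<exists>j<length (X # ws'). zs ! i = ys' ! j \<and> P (ws ! i) ((X # ws') ! j)"
      by (intro exI[of _ "Suc j"]) (simp add: ys(1))
  qed (rule zs(2))
next
  case (list_emb_Cons2 X X' ws ws')
  then obtain y ys where ys: "ys' = y # ys" "length ys = length ws'" by (auto simp: length_Suc_conv)
  from list_emb_Cons2.IH[OF ys(2)] obtain zs where zs: "subseq zs ys" "length zs = length ws"
    "\<forall>i<length ws. \<exists>j<length ws'. zs ! i = ys ! j \<and> P (ws ! i) (ws' ! j)" by blast
  show ?case
  proof (intro exI[of _ "y # zs"] conjI allI impI)
    show "subseq (y # zs) ys'" using zs(1) ys(1) by simp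
    show "length (y # zs) = length (X # ws)" using zs(2) by simp
    fix i assume i: "i < length (X # ws)"
    show "\<exists>j<length (X' # ws'). (y # zs) ! i = ys' ! j \<and> P ((X # ws) ! i) ((X' # ws') ! j)"
    proof (cases i)
      case 0
      then show ?thesis using list_emb_Cons2.hyps ys(1) by (intro exI[of _ 0]) simp
    next
      case (Suc k)
      with i zs(3) obtain j where "j < length ws'" "zs ! k = ys ! j" "P (ws ! k) (ws' ! j)" by auto
      then show ?thesis using Suc by (intro exI[of _ "Suc j"]) (simp add: ys(1))
    qed
  qed
qed

lemma sorted_wrt_subseq: "subseq xs ys \<Longrightarrow> sorted_wrt P ys \<Longrightarrow> sorted_wrt P xs"
  by (induction rule: list_emb.induct) (auto dest: list_emb_set)

text \<open>Fixes the witnesses of \<open>almost_multichainable\<close>, so that the argument can be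
  instantiated again for the coloured structures.\<close>

locale multichain =
  fixes \<mu> :: "'i signature" and R :: "('a, 'i) rel_structure"
    and F :: "'a set" and V :: "'v set" and L :: "'l set" and r :: "'l rel"
    and a :: "'v \<times> 'l \<Rightarrow> 'a"
  assumes structure_R: "structure_of \<mu> R"
    and finite_F: "finite F" and F_subset: "F \<subseteq> universe R" and finite_V: "finite V"
    and linear: "linear_order_on L r"
    and bij_a: "bij_betw a (V \<times> L) (universe R - F)"
    and extend_local_iso: "\<And>A f. local_iso order_signature (order_struct L r) A f \<Longrightarrow>
      local_iso \<mu> R (F \<union> a ` (V \<times> A)) (extend_map F V L a f)"
begin

section \<open>Increasing lists in the chain \<open>L\<close>\<close>

abbreviation before :: "'l \<Rightarrow> 'l \<Rightarrow> bool" where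
  "before y z \<equiv> (y, z) \<in> r \<and> y \<noteq> z"

lemma before_total: "\<lbrakk>y \<in> L; z \<in> L; y \<noteq> z\<rbrakk> \<Longrightarrow> before y z \<or> before z y"
  and r_trans: "(y, z) \<in> r \<Longrightarrow> (z, w) \<in> r \<Longrightarrow> (y, w) \<in> r"
  and r_antisym: "(y, z) \<in> r \<Longrightarrow> (z, y) \<in> r \<Longrightarrow> y = z"
  and r_refl: "y \<in> L \<Longrightarrow> (y, y) \<in> r"
  using linear unfolding order_on_defs total_on_def refl_on_def
  by (blast, blast dest: transD, blast dest: antisymD, blast)

lemma sorted_nth_iff:
  assumes "sorted_wrt before ys" "set ys \<subseteq> L" "i < length ys" "j < length ys"
  shows "(ys ! i, ys ! j) \<in> r \<longleftrightarrow> i \<le> j"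
proof (cases i j rule: linorder_cases)
  case less
  then show ?thesis using sorted_wrt_nth_less[OF assms(1) less assms(4)] by simp
next
  case equal
  then show ?thesis using assms r_refl nth_mem by blast
next
  case greater
  then show ?thesis using sorted_wrt_nth_less[OF assms(1) greater assms(3)] r_antisym by auto
qed

lemma sorted_list_exists:
  assumes "finite Y" "Y \<subseteq> L"
  shows "\<exists>ys. sorted_wrt before ys \<and> set ys = Y"
  using assms
proof (induction rule: finite_induct)
  case (insert y Y)
  then obtain ys where ys: "sorted_wrt before ys" "set ys = Y" by auto
  let ?zs = "filter (\<lambda>z. before z y) ys @ y # filter (\<lambda>z. before y z) ys"
  have "sorted_wrt before ?zs"
    using ys r_trans r_antisym by (auto simp: sorted_wrt_append sorted_wrt_filter)
  moreover have "set ?zs = insert y Y" using ys insert before_total[of y] by auto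
  ultimately show ?case by blast
qed simp

text \<open>In an increasing list the order of entries is the order of indices, and \<open>f\<close>
  preserves indices.\<close>

lemma order_local_iso:
  assumes ys: "sorted_wrt before ys" "set ys \<subseteq> L" and zs: "sorted_wrt before zs" "set zs \<subseteq> L"
    and len: "length ys = length zs" and f: "\<And>i. i < length ys \<Longrightarrow> f (ys ! i) = zs ! i"
  shows "local_iso order_signature (order_struct L r) (set ys) f"
proof -
  have f_L: "f y \<in> L" if "y \<in> set ys" for y
    using that f zs(2) len by (metis in_set_conv_nth nth_mem subsetD)
  have iff: "(y, z) \<in> r \<longleftrightarrow> (f y, f z) \<in> r" if "y \<in> set ys" "z \<in> set ys" for y z
  proof -
    obtain i j where "i < length ys" "y = ys ! i" "j < length ys" "z = ys ! j"
      using \<open>y \<in> set ys\<close> \<open>z \<in> set ys\<close> by (metis in_set_conv_nth)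
    then show ?thesis using f sorted_nth_iff[OF ys] sorted_nth_iff[OF zs] len by simp
  qed
  \<comment> \<open>Points with equal images have images related both ways, so they are related both
    ways themselves.\<close>
  have "inj_on f (set ys)"
  proof (rule inj_onI)
    fix y z assume yz: "y \<in> set ys" "z \<in> set ys" "f y = f z"
    then have "(f y, f z) \<in> r" "(f z, f y) \<in> r" using r_refl f_L by metis+
    then show "y = z" using iff yz r_antisym by blast
  qed
  then have "is_iso order_signature (induced (order_struct L r) (set ys))
      (induced (order_struct L r) (f ` set ys)) f"
    using iff f_L ys(2)
    by (auto simp: is_iso_def bij_betw_def order_signature_def order_struct_def
        length_Suc_conv numeral_2_eq_2)
  moreover have "f ` set ys \<subseteq> L" using f_L by blast
  ultimately show ?thesis using ys(2) by (simp add: local_iso_def order_struct_def)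
qed

section \<open>Codes of finite parts\<close>

definition points :: "'v set list \<Rightarrow> 'l list \<Rightarrow> 'a set" where
  "points ws ys = {a (x, ys ! i) | x i. i < length ws \<and> x \<in> ws ! i}"

text \<open>Letters may be empty, so codes are not unique. They need not be; this makes the code of a
  subset a letterwise smaller word of the same length.\<close>

definition codes :: "'a set \<Rightarrow> 'v set list \<Rightarrow> 'a set \<Rightarrow> bool" where
  "codes G ws A \<longleftrightarrow> G \<subseteq> F \<and> set ws \<subseteq> Pow V \<and>
     (\<exists>ys. sorted_wrt before ys \<and> set ys \<subseteq> L \<and> length ys = length ws \<and> A = G \<union> points ws ys)"

lemma codes_imp_finite:
  assumes "codes G ws A"
  shows "finite A" "A \<subseteq> universe R"
proof -
  obtain ys where G: "G \<subseteq> F" and ws: "set ws \<subseteq> Pow V" and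
    ys: "set ys \<subseteq> L" "length ys = length ws" "A = G \<union> points ws ys"
    using assms by (auto simp: codes_def)
  have "points ws ys \<subseteq> a ` (V \<times> set ys)"
    using ws ys(2) nth_mem by (fastforce simp: points_def)
  moreover have "a ` (V \<times> set ys) \<subseteq> universe R"
    using bij_a ys(1) by (auto simp: bij_betw_def)
  ultimately show "finite A" "A \<subseteq> universe R"
    using G F_subset finite_F finite_V unfolding ys(3)
    by (auto intro: finite_subset)
qed

lemma codes_exist:
  assumes "finite A" "A \<subseteq> universe R"
  shows "\<exists>ws. codes (A \<inter> F) ws A"
proof -
  \<comment> \<open>Only elements of \<open>L\<close> over which \<open>A\<close> has a point are
    listed; they are finitely many because \<open>a\<close> is injective.\<close>
  define Y where "Y = {y \<in> L. \<exists>x\<in>V. a (x, y) \<in> A}"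
  have "finite {k \<in> V \<times> L. a k \<in> A}"
    using bij_a finite_vimage_IntI[OF assms(1), of a "V \<times> L"]
    by (auto simp: bij_betw_def vimage_def Int_def conj_commute)
  then have "finite Y"
    by (rule finite_subset[rotated, OF finite_imageI[of _ snd]]) (force simp: Y_def)
  then obtain ys where ys: "sorted_wrt before ys" "set ys = Y"
    using sorted_list_exists[of Y] by (auto simp: Y_def)
  define ws where "ws = map (\<lambda>y. {x \<in> V. a (x, y) \<in> A}) ys"
  have "z \<in> points ws ys" if z: "z \<in> A" "z \<notin> F" for z
  proof -
    have "z \<in> a ` (V \<times> L)" using bij_a z assms(2) by (auto simp: bij_betw_def)
    then obtain x y where xy: "x \<in> V" "y \<in> L" "z = a (x, y)" by blast
    then have "y \<in> set ys" using z ys(2) by (auto simp: Y_def)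
    then obtain i where "i < length ys" "ys ! i = y" by (auto simp: in_set_conv_nth)
    moreover from this have "x \<in> ws ! i" using xy z by (simp add: ws_def)
    moreover have "length ws = length ys" by (simp add: ws_def)
    ultimately show ?thesis using xy(3) unfolding points_def by auto
  qed
  then have "A = A \<inter> F \<union> points ws ys" by (auto simp: points_def ws_def)
  moreover have "set ys \<subseteq> L" using ys(2) by (auto simp: Y_def)
  ultimately have "codes (A \<inter> F) ws A"
    unfolding codes_def using ys(1) by (auto simp: ws_def intro!: exI[of _ ys])
  then show ?thesis ..
qed

lemma codes_subset:
  assumes "codes G ws A" "B \<subseteq> A"
  shows "\<exists>G' ws'. codes G' ws' B \<and> G' \<subseteq> G \<and> list_all2 (\<subseteq>) ws' ws"
proof -
  obtain ys where G: "G \<subseteq> F" and ws: "set ws \<subseteq> Pow V" and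
    ys: "sorted_wrt before ys" "set ys \<subseteq> L" "length ys = length ws" "A = G \<union> points ws ys"
    using assms by (auto simp: codes_def)
  define ws' where "ws' = map2 (\<lambda>X y. {x \<in> X. a (x, y) \<in> B}) ws ys"
  have len: "length ws' = length ws" using ys(3) by (simp add: ws'_def)
  have nth: "ws' ! i = {x \<in> ws ! i. a (x, ys ! i) \<in> B}" if "i < length ws" for i
    using that ys(3) by (simp add: ws'_def)
  have "points ws' ys = points ws ys \<inter> B"
    unfolding points_def len using nth by blast
  then have "B = (G \<inter> B) \<union> points ws' ys" using assms(2) ys(4) by blast
  moreover have le: "list_all2 (\<subseteq>) ws' ws"
    using ys(3) by (auto simp: ws'_def list_all2_conv_all_nth)
  moreover have "set ws' \<subseteq> Pow V"
    using ws by (auto simp: ws'_def dest: set_zip_leftD)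
  moreover have "length ys = length ws'" using ys(3) by (simp add: ws'_def)
  ultimately have "codes (G \<inter> B) ws' B"
    unfolding codes_def using G ys(1,2) by blast
  then show ?thesis using le by blast
qed

text \<open>The local isomorphism of \<open>L\<close> taking \<open>ys\<close> to \<open>zs\<close>,
  extended by the identity on \<open>F\<close>, sends \<open>a (x, ys ! i)\<close> to
  \<open>a (x, ys' ! j)\<close> for the matched position \<open>j\<close>. The inclusion of letters
  keeps the image inside \<open>A'\<close>.\<close>

lemma codes_embeds:
  assumes "codes G ws A" "codes G' ws' A'" "G \<subseteq> G'" "list_emb (\<subseteq>) ws ws'"
  shows "embeds \<mu> (induced R A) (induced R A')"
proof -
  obtain ys where G: "G \<subseteq> F" and ws: "set ws \<subseteq> Pow V" and
    ys: "sorted_wrt before ys" "set ys \<subseteq> L" "length ys = length ws" "A = G \<union> points ws ys"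
    using assms(1) by (auto simp: codes_def)
  obtain ys' where
    ys': "sorted_wrt before ys'" "set ys' \<subseteq> L" "length ys' = length ws'" "A' = G' \<union> points ws' ys'"
    using assms(2) by (auto simp: codes_def)
  obtain zs where zs: "subseq zs ys'" "length zs = length ws"
    "\<And>i. i < length ws \<Longrightarrow> \<exists>j<length ws'. zs ! i = ys' ! j \<and> ws ! i \<subseteq> ws' ! j"
    using list_emb_positions[OF assms(4) ys'(3)] by blast
  \<comment> \<open>Off \<open>ys\<close> the value of \<open>f\<close> is unspecified;
    \<open>local_iso\<close> only looks at \<open>set ys\<close>.\<close>
  define f where "f y = the (map_of (zip ys zs) y)" for y
  have "distinct ys"
    using ys(1) by (induction ys) auto
  then have f: "f (ys ! i) = zs ! i" if "i < length ys" for i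
    using that ys(3) zs(2) by (simp add: f_def map_of_zip_nth)
  have "set zs \<subseteq> L" using zs(1) ys'(2) by (auto dest: list_emb_set)
  then have "local_iso order_signature (order_struct L r) (set ys) f"
    using sorted_wrt_subseq[OF zs(1) ys'(1)] f ys zs(2) by (intro order_local_iso[of _ zs]) auto
  from extend_local_iso[OF this] have
    e: "is_iso \<mu> (induced R (F \<union> a ` (V \<times> set ys)))
      (induced R (extend_map F V L a f ` (F \<union> a ` (V \<times> set ys)))) (extend_map F V L a f)"
    (is "is_iso _ (induced R ?E) (induced R (?e ` ?E)) ?e") by (simp add: local_iso_def)
  have "points ws ys \<subseteq> a ` (V \<times> set ys)"
    using ws ys(3) nth_mem by (fastforce simp: points_def)
  then have "A \<subseteq> ?E" using G ys(4) by blast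
  with is_iso_induced[OF e, of A] have "is_iso \<mu> (induced R A) (induced R (?e ` A)) ?e"
    by (simp add: induced_induced image_mono)
  moreover have "?e ` A \<subseteq> A'"
  proof
    fix w assume "w \<in> ?e ` A"
    then obtain z where z: "z \<in> A" "w = ?e z" by blast
    show "w \<in> A'"
    proof (cases "z \<in> G")
      case True
      then show ?thesis using z(2) G assms(3) ys'(4) by (auto simp: extend_map_def)
    next
      case False
      then obtain x i where i: "z = a (x, ys ! i)" "i < length ws" "x \<in> ws ! i"
        using z(1) ys(4) by (auto simp: points_def)
      have xi: "(x, ys ! i) \<in> V \<times> L"
        using i ws ys(2,3) nth_mem[of i ws] nth_mem[of i ys] by (auto simp del: nth_mem)
      then have "z \<notin> F" using bij_a i(1) by (auto simp: bij_betw_def)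
      moreover have "the_inv_into (V \<times> L) a z = (x, ys ! i)"
        using xi bij_a i(1) by (simp add: the_inv_into_f_f bij_betw_def)
      ultimately have "w = a (x, zs ! i)"
        using z(2) f i(2) ys(3) by (simp add: extend_map_def)
      moreover obtain j where "j < length ws'" "zs ! i = ys' ! j" "ws ! i \<subseteq> ws' ! j"
        using zs(3)[OF i(2)] by blast
      ultimately show ?thesis using i(3) ys'(4) by (auto simp: points_def)
    qed
  qed
  ultimately show ?thesis unfolding embeds_def isomorphic_def
    by (intro exI[of _ "?e ` A"]) (auto simp: induced_induced)
qed

text \<open>A type belongs to a cell as soon as one of its realisations in \<open>R\<close> has one
  code there; its other codes may lie elsewhere.\<close>

definition cell :: "'a set \<times> 'v set atom list \<Rightarrow> (nat, 'i) rel_structure set set" where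
  "cell k = {iso_type \<mu> (induced R A) | A H w. codes H w A \<and> H \<subseteq> fst k \<and> w \<in> lang (snd k)}"

text \<open>Every permitted point of \<open>F\<close> counts one unit at exponent 0, so that
  forbidding a point lowers the rank.\<close>

definition cell_rank :: "'a set \<times> 'v set atom list \<Rightarrow> nat \<Rightarrow> nat" where
  "cell_rank k n = rank (snd k) n + (if n = 0 then card (fst k) else 0)"

sublocale peeling "type_le \<mu>" "Omega \<mu>" "{k. fst k \<subseteq> F \<and> good (snd k)}" cell cell_rank
proof
  fix k :: "'a set \<times> 'v set atom list" assume "k \<in> {k. fst k \<subseteq> F \<and> good (snd k)}"
  have "finite {n :: nat. (if n = 0 then card (fst k) else 0) \<noteq> 0}"
    by (rule finite_subset[of _ "{0}"]) auto
  then have "finite ({n. rank (snd k) n \<noteq> 0} \<union> {n. (if n = 0 then card (fst k) else 0) \<noteq> 0})"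
    using finite_rank by blast
  then show "finite {n. cell_rank k n \<noteq> 0}"
    by (rule finite_subset[rotated]) (auto simp: cell_rank_def)
next
  fix k x y
  assume k: "k \<in> {k. fst k \<subseteq> F \<and> good (snd k)}" and x: "x \<in> cell k"
    and y: "y \<in> Omega \<mu>" "type_le \<mu> y x"
  obtain A H w where A: "x = iso_type \<mu> (induced R A)" "codes H w A" "H \<subseteq> fst k" "w \<in> lang (snd k)"
    using x unfolding cell_def by blast
  obtain B where B: "B \<subseteq> A" "y = iso_type \<mu> (induced R B)"
    using below_age_member[OF structure_R codes_imp_finite(1)[OF A(2)] y(1)] y(2) A(1) by metis
  obtain H' w' where H': "codes H' w' B" "H' \<subseteq> H" "list_all2 (\<subseteq>) w' w"
    using codes_subset[OF A(2) B(1)] by blast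
  have "w' \<in> lang (snd k)" using lang_downward[OF _ A(4) H'(3)] k by simp
  then show "y \<in> cell k" unfolding cell_def using B(2) H'(1,2) A(3) by blast
next
  fix k t
  assume k: "k \<in> {k. fst k \<subseteq> F \<and> good (snd k)}" and t: "t \<in> cell k"
  obtain G p where Gp: "k = (G, p)" by (cases k)
  have G: "G \<subseteq> F" "finite G" and p: "good p"
    using k Gp finite_F by (auto intro: finite_subset)
  obtain A H w where A: "t = iso_type \<mu> (induced R A)" "codes H w A" "H \<subseteq> G" "w \<in> lang p"
    using t Gp unfolding cell_def by auto
  obtain Q where Q: "finite Q" "\<And>q. q \<in> Q \<Longrightarrow> good q \<and> (rank q, rank p) \<in> cnf_less"
    "\<And>u. u \<in> lang p \<Longrightarrow> \<not> list_emb (\<subseteq>) w u \<Longrightarrow> \<exists>q\<in>Q. u \<in> lang q"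
    using lang_peel[OF p A(4)] by blast
  \<comment> \<open>A type not above \<open>t\<close> with code \<open>(I, v)\<close> either misses
    some \<open>g\<close> in \<open>H\<close>, which is then removed from \<open>G\<close>, or has a
    word \<open>v\<close> not above \<open>w\<close>, which \<open>lang_peel\<close> covers.\<close>
  let ?Q = "(\<lambda>g. (G - {g}, p)) ` H \<union> Pair G ` Q"
  have fin: "finite {n :: nat. (if n = 0 then c else 0) \<noteq> (0 :: nat)}" for c
    by (rule finite_subset[of _ "{0 :: nat}"]) auto
  have fin_rank: "finite {n. cell_rank k' n \<noteq> 0}" for k'
    by (rule finite_subset[OF _ finite_UnI[OF finite_rank[of "snd k'"] fin[of "card (fst k')"]]])
      (auto simp: cell_rank_def)
  have "(cell_rank q, cell_rank k) \<in> cnf_less" if q: "q \<in> ?Q" for q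
  proof -
    from q consider g where "g \<in> H" "q = (G - {g}, p)" | q' where "q' \<in> Q" "q = (G, q')" by blast
    then show ?thesis
    proof cases
      case 1
      then have "card (G - {g}) < card G" using A(3) G(2) by (intro psubset_card_mono) auto
      then show ?thesis
        by (intro cnf_lessI[OF fin_rank fin_rank, where n = 0]) (auto simp: cell_rank_def Gp 1)
    next
      case 2
      then show ?thesis
        using cnf_less_add_right[OF _ fin[of "card G"], of "rank q'" "rank p"] Q(2)[OF 2(1)]
        unfolding cell_rank_def[abs_def] Gp 2(2) fst_conv snd_conv by blast
    qed
  qed
  moreover have "\<exists>q\<in>?Q. u \<in> cell q" if u: "u \<in> cell k" "\<not> type_le \<mu> t u" for u
  proof -
    obtain B I v where B: "u = iso_type \<mu> (induced R B)" "codes I v B" "I \<subseteq> G" "v \<in> lang p"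
      using u Gp unfolding cell_def by auto
    have "\<not> embeds \<mu> (induced R A) (induced R B)"
      using u(2) codes_imp_finite[OF A(2)] codes_imp_finite[OF B(2)]
      unfolding A(1) B(1) by (simp add: type_le_iff structure_of_induced structure_R)
    then have "\<not> (H \<subseteq> I \<and> list_emb (\<subseteq>) w v)" using codes_embeds[OF A(2) B(2)] by blast
    then consider g where "g \<in> H" "I \<subseteq> G - {g}" | q where "q \<in> Q" "v \<in> lang q"
      using B(3,4) Q(3) by blast
    then show ?thesis
    proof cases
      case 1
      then have "u \<in> cell (G - {g}, p)" unfolding cell_def using B by auto
      then show ?thesis using 1 by blast
    next
      case 2
      then have "u \<in> cell (G, q)" unfolding cell_def using B by auto
      then show ?thesis using 2 by blast
    qed
  qed
  moreover have "finite ?Q" using Q(1) A(3) G(2) by (simp add: finite_subset)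
  moreover have "?Q \<subseteq> {k. fst k \<subseteq> F \<and> good (snd k)}" using G(1) p Q(2) by auto
  ultimately show "\<exists>Q\<subseteq>{k. fst k \<subseteq> F \<and> good (snd k)}. finite Q \<and>
      (\<forall>q\<in>Q. (cell_rank q, cell_rank k) \<in> cnf_less) \<and>
      (\<forall>u\<in>cell k. \<not> type_le \<mu> t u \<longrightarrow> (\<exists>q\<in>Q. u \<in> cell q))"
    by (intro exI[of _ ?Q]) blast
qed

text \<open>This cell contains the whole age. Its rank is \<omega>^(2^|V|) + |F|, below
  \<omega>^\<omega> for every finite \<open>F\<close> and \<open>V\<close>.\<close>

lemma full_cell: "(F, [Star (Pow V)]) \<in> {k. fst k \<subseteq> F \<and> good (snd k)}"
  using finite_V by (auto simp: good_atom_def)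

lemma age_subset_full_cell: "age \<mu> R \<subseteq> cell (F, [Star (Pow V)])"
proof
  fix t assume "t \<in> age \<mu> R"
  then obtain A where A: "t = iso_type \<mu> (induced R A)" "finite A" "A \<subseteq> universe R"
    by (auto simp: age_def)
  then obtain ws where ws: "codes (A \<inter> F) ws A" using codes_exist by blast
  then have "ws \<in> lang [Star (Pow V)]" by (auto simp: codes_def)
  then show "t \<in> cell (F, [Star (Pow V)])" unfolding cell_def using A(1) ws by auto
qed

lemma wqo_age: "well_quasi_ordered (type_le \<mu>) (age \<mu> R)"
  using good_sequence[OF full_cell] age_subset_full_cell
  by (intro well_quasi_ordered_age[OF structure_R]) blast

lemma age_height:
  "\<exists>\<alpha> :: nat rel. has_age_height \<mu> (age \<mu> R) \<alpha> \<and> (\<alpha>, omega_pow_omega) \<in> ordLess"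
  unfolding has_age_height_def
  by (rule ideal_height[OF order_ideal_age[OF structure_R] full_cell age_subset_full_cell])

end

section \<open>Adding unary relations\<close>

text \<open>Every point of \<open>R\<close> is replaced by one copy for each set of unary relations it may satisfy.
  The expansions of members of the age of \<open>R\<close> then belong to the age of a single structure, which
  is again almost multichainable.\<close>

definition colored :: "nat \<Rightarrow> ('a, 'i) rel_structure \<Rightarrow> ('a \<times> nat set, 'i + nat) rel_structure" where
  "colored m R = \<lparr>universe = universe R \<times> Pow {..<m},
     rel = case_sum (\<lambda>i. {xs. set xs \<subseteq> universe R \<times> Pow {..<m} \<and> map fst xs \<in> rel R i})
       (\<lambda>j. {[(z, c)] | z c. z \<in> universe R \<and> c \<subseteq> {..<m} \<and> j \<in> c})\<rparr>"

lemma structure_of_colored: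
  assumes "structure_of \<mu> R"
  shows "structure_of (add_unary_signature m \<mu>) (colored m R)"
  using assms
  by (fastforce simp: structure_of_def colored_def add_unary_signature_def)

lemma induced_colored:
  assumes "E \<subseteq> universe R"
  shows "induced (colored m R) (E \<times> Pow {..<m}) = colored m (induced R E)"
proof -
  have "(set xs \<subseteq> universe R \<times> Pow {..<m} \<and> map fst xs \<in> rel R i) \<and> set xs \<subseteq> E \<times> Pow {..<m} \<longleftrightarrow>
      set xs \<subseteq> E \<times> Pow {..<m} \<and> map fst xs \<in> rel R i \<and> set (map fst xs) \<subseteq> E" for xs i
    using assms by fastforce
  then show ?thesis
    using assms by (auto simp: induced_def colored_def fun_eq_iff split: sum.split)
qed

lemma is_iso_cong:
  assumes "\<And>x. x \<in> universe S \<Longrightarrow> f x = g x"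
  shows "is_iso \<mu> S T f \<longleftrightarrow> is_iso \<mu> S T g"
proof -
  have "map f xs = map g xs" if "set xs \<subseteq> universe S" for xs using assms that by auto
  moreover have "bij_betw f (universe S) (universe T) \<longleftrightarrow> bij_betw g (universe S) (universe T)"
    using assms by (rule bij_betw_cong)
  ultimately show ?thesis unfolding is_iso_def by metis
qed

lemma is_iso_colored:
  assumes "is_iso \<mu> S T f"
  shows "is_iso (add_unary_signature m \<mu>) (colored m S) (colored m T) (map_prod f id)"
  unfolding is_iso_def
proof (intro conjI ballI allI impI)
  have f: "bij_betw f (universe S) (universe T)" using assms by (simp add: is_iso_def)
  then have fT: "f z \<in> universe T" if "z \<in> universe S" for z using that by (auto simp: bij_betw_def)
  show "bij_betw (map_prod f id) (universe (colored m S)) (universe (colored m T))"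
    using f by (simp add: colored_def bij_betw_map_prod)
  fix i xs
  assume i: "i \<in> idx (add_unary_signature m \<mu>)"
    and xs: "length xs = arity (add_unary_signature m \<mu>) i \<and> set xs \<subseteq> universe (colored m S)"
  show "(xs \<in> rel (colored m S) i) = (map (map_prod f id) xs \<in> rel (colored m T) i)"
  proof (cases i)
    case (Inl i')
    have xs_S: "set xs \<subseteq> universe S \<times> Pow {..<m}" using xs by (simp add: colored_def)
    have "set (map (map_prod f id) xs) \<subseteq> universe T \<times> Pow {..<m}" using xs_S fT by fastforce
    moreover have "map fst (map (map_prod f id) xs) = map f (map fst xs)" by simp
    moreover have "map fst xs \<in> rel S i' \<longleftrightarrow> map f (map fst xs) \<in> rel T i'"
    proof -
      have "i' \<in> idx \<mu>" "length (map fst xs) = arity \<mu> i'" "set (map fst xs) \<subseteq> universe S"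
        using i xs xs_S Inl by (auto simp: add_unary_signature_def)
      then show ?thesis using assms unfolding is_iso_def by blast
    qed
    ultimately show ?thesis using xs_S Inl by (simp add: colored_def)
  next
    case (Inr j)
    then obtain z c where "xs = [(z, c)]" "z \<in> universe S" "c \<subseteq> {..<m}"
      using xs by (auto simp: add_unary_signature_def colored_def length_Suc_conv)
    then show ?thesis using Inr fT by (auto simp: colored_def)
  qed
qed

text \<open>Over each point the copy is chosen whose colour lists the unary relations holding there.
  One copy per point is used, so \<open>fst\<close> is injective on the chosen set.\<close>

lemma expansion_in_age_colored:
  assumes S: "S \<in> \<Union> (age \<mu> R)"
  shows "iso_type (add_unary_signature m \<mu>) (add_unary S U) \<in> age (add_unary_signature m \<mu>) (colored m R)"
proof -
  obtain A where A: "finite A" "A \<subseteq> universe R" "S \<in> iso_type \<mu> (induced R A)"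
    using S by (auto simp: age_def)
  then obtain g where g: "is_iso \<mu> (induced R A) S g" by (auto simp: iso_type_def isomorphic_def)
  define B where "B = (\<lambda>z. (z, {j. j < m \<and> g z \<in> U j})) ` A"
  have B: "finite B" "B \<subseteq> universe (colored m R)" "fst ` B = A"
    using A(1,2) by (auto simp: B_def colored_def image_image)
  have bij: "bij_betw g A (universe S)" using g by (simp add: is_iso_def)
  have "is_iso (add_unary_signature m \<mu>) (induced (colored m R) B) (add_unary S U) (g \<circ> fst)"
    unfolding is_iso_def
  proof (intro conjI ballI allI impI)
    have "bij_betw fst B A" using B(3) by (auto simp: bij_betw_def inj_on_def B_def)
    then show "bij_betw (g \<circ> fst) (universe (induced (colored m R) B)) (universe (add_unary S U))"
      using bij by (simp add: add_unary_def bij_betw_trans)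
    fix i xs
    assume i: "i \<in> idx (add_unary_signature m \<mu>)" and
      xs: "length xs = arity (add_unary_signature m \<mu>) i \<and> set xs \<subseteq> universe (induced (colored m R) B)"
    show "(xs \<in> rel (induced (colored m R) B) i) = (map (g \<circ> fst) xs \<in> rel (add_unary S U) i)"
    proof (cases i)
      case (Inl i')
      have i': "i' \<in> idx \<mu>" "length (map fst xs) = arity \<mu> i'" "set (map fst xs) \<subseteq> A"
        using i xs Inl B(3) by (auto simp: add_unary_signature_def)
      then have "map fst xs \<in> rel R i' \<longleftrightarrow> map g (map fst xs) \<in> rel S i'"
        using g by (auto simp: is_iso_def)
      then show ?thesis using Inl xs B(2) by (auto simp: colored_def add_unary_def)
    next
      case (Inr j)
      then obtain z where z: "xs = [(z, {j. j < m \<and> g z \<in> U j})]" "z \<in> A"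
        using xs by (auto simp: add_unary_signature_def length_Suc_conv B_def)
      have "j < m" using i Inr by (auto simp: add_unary_signature_def)
      then show ?thesis using Inr z xs A(2) by (auto simp: colored_def add_unary_def)
    qed
  qed
  then have "iso_type (add_unary_signature m \<mu>) (induced (colored m R) B) =
      iso_type (add_unary_signature m \<mu>) (add_unary S U)"
    by (intro iso_type_eqI) (auto simp: isomorphic_def)
  then show ?thesis using B(1,2) unfolding age_def by blast
qed

context multichain
begin

text \<open>The colours go into \<open>F\<close> and \<open>V\<close>, never into \<open>L\<close>.
  The local isomorphisms of the chain are thus the same, and their extensions act on first
  components while fixing colours.\<close>

lemma multichain_colored:
  "multichain (add_unary_signature m \<mu>) (colored m R) (F \<times> Pow {..<m}) (V \<times> Pow {..<m}) L r
     (\<lambda>((x, c), y). (a (x, y), c))"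
proof
  let ?C = "Pow {..<m}" and ?a = "\<lambda>((x, c), y). (a (x, y), c)"
  show "structure_of (add_unary_signature m \<mu>) (colored m R)"
    by (rule structure_of_colored[OF structure_R])
  show "finite (F \<times> ?C)" "finite (V \<times> ?C)" using finite_F finite_V by simp_all
  show "F \<times> ?C \<subseteq> universe (colored m R)" using F_subset by (auto simp: colored_def)
  show "linear_order_on L r" by (rule linear)
  have image: "?a ` ((V \<times> ?C) \<times> A) = a ` (V \<times> A) \<times> ?C" for A by force
  have inj: "inj_on ?a ((V \<times> ?C) \<times> L)"
    using bij_a by (auto simp: bij_betw_def inj_on_def)
  have "a ` (V \<times> L) = universe R - F" using bij_a by (simp add: bij_betw_def)
  then show "bij_betw ?a ((V \<times> ?C) \<times> L) (universe (colored m R) - F \<times> ?C)"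
    using inj image[of L] by (auto simp: bij_betw_def colored_def)
  fix A f assume f: "local_iso order_signature (order_struct L r) A f"
  let ?E = "F \<union> a ` (V \<times> A)" and ?e = "extend_map F V L a f"
  let ?e' = "extend_map (F \<times> ?C) (V \<times> ?C) L ?a f"
  have E: "?E \<subseteq> universe R" "?e ` ?E \<subseteq> universe R" "is_iso \<mu> (induced R ?E) (induced R (?e ` ?E)) ?e"
    using extend_local_iso[OF f] by (auto simp: local_iso_def)
  have AL: "A \<subseteq> L" using f by (simp add: local_iso_def order_struct_def)
  have E': "F \<times> ?C \<union> ?a ` ((V \<times> ?C) \<times> A) = ?E \<times> ?C" unfolding image by blast
  \<comment> \<open>Agreement is claimed only on this product, where the inverses of both
    enumerations have prescribed values; \<open>is_iso_cong\<close> needs no more.\<close>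
  have e': "?e' p = map_prod ?e id p" if in_EC: "p \<in> ?E \<times> ?C" for p
  proof -
    obtain z c where p: "p = (z, c)" "z \<in> ?E" "c \<in> ?C" using in_EC by blast
    show ?thesis
    proof (cases "z \<in> F")
      case True
      then show ?thesis using p by (simp add: extend_map_def)
    next
      case False
      then obtain x y where xy: "x \<in> V" "y \<in> L" "z = a (x, y)" using p(2) AL by blast
      have "the_inv_into (V \<times> L) a (a (x, y)) = (x, y)"
        using bij_a xy by (intro the_inv_into_f_f) (auto simp: bij_betw_def)
      moreover have "the_inv_into ((V \<times> ?C) \<times> L) ?a (?a ((x, c), y)) = ((x, c), y)"
        using xy p(3) by (intro the_inv_into_f_f[OF inj]) auto
      ultimately show ?thesis using False p(1) xy(3) by (simp add: extend_map_def)
    qed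
  qed
  have img: "?e' ` (?E \<times> ?C) = ?e ` ?E \<times> ?C"
  proof -
    have "?e' ` (?E \<times> ?C) = map_prod ?e id ` (?E \<times> ?C)" using e' by (rule image_cong[OF refl])
    also have "\<dots> = ?e ` ?E \<times> ?C" by (simp add: map_prod_surj_on)
    finally show ?thesis .
  qed
  have "is_iso (add_unary_signature m \<mu>) (colored m (induced R ?E)) (colored m (induced R (?e ` ?E))) ?e'"
    using is_iso_colored[OF E(3), of m] e'
      is_iso_cong[of "colored m (induced R ?E)" ?e' "map_prod ?e id"]
    by (simp add: colored_def)
  then show "local_iso (add_unary_signature m \<mu>) (colored m R) (F \<times> ?C \<union> ?a ` ((V \<times> ?C) \<times> A)) ?e'"
    unfolding local_iso_def E' img induced_colored[OF E(1)] induced_colored[OF E(2)]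
    using E(1,2) by (auto simp: colored_def)
qed

text \<open>The expansions form in general only a part of the age of the coloured structure, where a
  point may occur in several colours; well-quasi-order passes to subsets.\<close>

lemma very_wqo_age: "very_well_quasi_ordered \<mu> (age \<mu> R)"
  unfolding very_well_quasi_ordered_def
proof
  fix m
  interpret c: multichain "add_unary_signature m \<mu>" "colored m R" "F \<times> Pow {..<m}"
    "V \<times> Pow {..<m}" L r "\<lambda>((x, c), y). (a (x, y), c)"
    by (rule multichain_colored)
  show "well_quasi_ordered (type_le (add_unary_signature m \<mu>))
      {iso_type (add_unary_signature m \<mu>) (add_unary S U) | S U.
        S \<in> \<Union> (age \<mu> R) \<and> (\<forall>j<m. U j \<subseteq> universe S)}"
    by (rule well_quasi_ordered_subset[OF c.wqo_age]) (auto intro: expansion_in_age_colored)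
qed

end

theorem mainTheorem10:
  fixes \<mu> :: "'i signature"
    and R :: "('a, 'i) rel_structure"
    and \<A> :: "(nat, 'i) rel_structure set set"
  assumes "structure_of \<mu> R"
    and "almost_multichainable TYPE('v) TYPE('l) \<mu> R"
    and "\<A> = age \<mu> R"
  shows "very_well_quasi_ordered \<mu> \<A> \<and>
    (\<exists>\<alpha> :: nat rel. has_age_height \<mu> \<A> \<alpha> \<and> (\<alpha>, omega_pow_omega) \<in> ordLess)"
proof -
  obtain F and V :: "'v set" and L :: "'l set" and r a where "multichain \<mu> R F V L r a"
    using assms(1,2) unfolding almost_multichainable_def multichain_def by metis
  then interpret multichain \<mu> R F V L r a .
  show ?thesis unfolding assms(3) using very_wqo_age age_height by blast
qed

end
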